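(* Let $m,a,b>0$ and $q>2$. If $u\in C^1(\overline B_1\setminus\{0\})$ is a positive solution of $$-\Delta u+ae^{bu}-m|\nabla u|^q=0\quad\text{in } B_1\setminus\{0\},$$ then (i) either $$\lim_{x\to 0}\frac{u(x)}{-\ln|x|}=\frac qb,$$ (ii) or $u$ can be extended to $\overline B_1$ as a H\"older continuous function.
   Context: $B_1$ is the open unit disk of $\mathbb R^2$ centered at $0$. A $C^1$ solution of the equation in $B_1\setminus\{0\}$ is understood to satisfy it in the sense of distributions in $B_1\setminus\{0\}$. *)

theory Defs
  imports "HOL-Analysis.Analysis"
begin

definition partial_deriv :: "('a::euclidean_space \<Rightarrow> real) \<Rightarrow> 'a \<Rightarrow> 'a \<Rightarrow> real" where
  "partial_deriv f i x = frechet_derivative f (at x) i"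

definition grad :: "('a::euclidean_space \<Rightarrow> real) \<Rightarrow> 'a \<Rightarrow> 'a" where
  "grad f x = (\<Sum>i\<in>Basis. partial_deriv f i x *\<^sub>R i)"

definition laplacian :: "('a::euclidean_space \<Rightarrow> real) \<Rightarrow> 'a \<Rightarrow> real" where
  "laplacian f x = (\<Sum>i\<in>Basis. partial_deriv (partial_deriv f i) i x)"

primrec C_k :: "nat \<Rightarrow> ('a::euclidean_space \<Rightarrow> real) \<Rightarrow> bool" where
  "C_k 0 f \<longleftrightarrow> continuous_on UNIV f"
| "C_k (Suc k) f \<longleftrightarrow>
     (\<forall>x. f differentiable (at x)) \<and> (\<forall>i\<in>Basis. C_k k (partial_deriv f i))"

definition test_function :: "'a::euclidean_space set \<Rightarrow> ('a \<Rightarrow> real) \<Rightarrow> bool" where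
  "test_function \<Omega> \<phi> \<longleftrightarrow>
     (\<forall>k. C_k k \<phi>) \<and> compact (closure {x. \<phi> x \<noteq> 0}) \<and> closure {x. \<phi> x \<noteq> 0} \<subseteq> \<Omega>"

text \<open>The class \<open>C\<^sup>1\<close> up to the boundary: \<open>S\<close> is a set such as a closed ball minus its centre,
  \<open>u\<close> is differentiable at the interior points of \<open>S\<close>, and both \<open>u\<close> and its gradient are
  continuous up to the boundary points that belong to \<open>S\<close>.\<close>

definition C1_up_to_boundary :: "'a::euclidean_space set \<Rightarrow> ('a \<Rightarrow> real) \<Rightarrow> bool" where
  "C1_up_to_boundary S u \<longleftrightarrow>
     continuous_on S u \<and>
     (\<exists>g. continuous_on S g \<and> (\<forall>x\<in>interior S. GDERIV u x :> g x))"

text \<open>\<open>- \<Delta>u + a e\<^sup>b\<^sup>u - m |\<nabla>u|\<^sup>q = 0\<close> in the sense of distributions in \<open>\<Omega>\<close>, meant for \<open>u\<close> of class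
  \<open>C\<^sup>1\<close> in the open set \<open>\<Omega>\<close>: the Laplacian is moved to the test function, and the gradient is the
  classical one. The integrand is then continuous with compact support in \<open>\<Omega>\<close>.\<close>

definition distributional_solution ::
    "real \<Rightarrow> real \<Rightarrow> real \<Rightarrow> real \<Rightarrow> 'a::euclidean_space set \<Rightarrow> ('a \<Rightarrow> real) \<Rightarrow> bool" where
  "distributional_solution m a b q \<Omega> u \<longleftrightarrow>
     (\<forall>\<phi>. test_function \<Omega> \<phi> \<longrightarrow>
        (LINT x:\<Omega>|lborel.
           - u x * laplacian \<phi> x + a * exp (b * u x) * \<phi> x
             - m * norm (grad u x) powr q * \<phi> x) = 0)"

definition hoelder_continuous_on :: "'a::metric_space set \<Rightarrow> ('a \<Rightarrow> 'b::metric_space) \<Rightarrow> bool" where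
  "hoelder_continuous_on S f \<longleftrightarrow>
     (\<exists>\<alpha> C. 0 < \<alpha> \<and> \<alpha> \<le> 1 \<and> (\<forall>x\<in>S. \<forall>y\<in>S. dist (f x) (f y) \<le> C * dist x y powr \<alpha>))"

end

theory Submission
  imports Defs
begin

text \<open>Let \<open>k = q/b\<close> and \<open>w = e\<^sup>-\<^sup>u\<^sup>/\<^sup>k\<close>, so that \<open>0 < w < 1\<close> and the equation becomes
  \<open>m k\<^sup>q |\<nabla>w|\<^sup>q + k w\<^sup>q\<^sup>-\<^sup>2 |\<nabla>w|\<^sup>2 = a + k w\<^sup>q\<^sup>-\<^sup>1 \<Delta>w\<close>, a perturbed eikonal equation. Mollification shows that where a
  smooth function touches \<open>u\<close> from above or below, its Laplacian is bounded below or above by that of \<open>u\<close>;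
  everything else is comparison with explicit radial functions.

  A logarithmic barrier on the ball of radius \<open>|y|/2\<close> about \<open>y\<close> gives \<open>w y \<ge> c |y|\<close>. As \<open>q > 2\<close>, the gradient term
  dominates, and \<open>w y + K (r\<^sup>\<alpha> + \<rho>\<^sup>\<alpha> - (\<rho> - r)\<^sup>\<alpha>)\<close> with \<open>r = |x - y|\<close>, \<open>\<alpha> = (q - 2)/(q - 1)\<close> lies above \<open>w\<close> on
  every closed ball about \<open>y\<close> that avoids the origin and the unit circle, with \<open>K\<close> independent of the ball. Hence \<open>w\<close>
  is Hoelder continuous near the origin with some limit \<open>w0 \<ge> 0\<close> there. If \<open>w0 > 0\<close>, then \<open>u = - k ln w\<close> is Hoelder continuous. If
  \<open>w0 = 0\<close>, comparison with \<open>|x|\<^sup>\<beta> (|x|\<^sup>2 + \<epsilon>)\<^sup>(\<^sup>1\<^sup>-\<^sup>\<beta>\<^sup>)\<^sup>/\<^sup>2\<close> as \<open>\<epsilon> \<rightarrow> 0\<close> gives \<open>w x \<le> C |x|\<close>, and with the lower bound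
  \<open>u / (- ln |x|)\<close> tends to \<open>k\<close>.\<close>

section \<open>Smooth compactly supported functions\<close>

lemma partial_derivI:
  assumes "(f has_derivative f') (at x)"
  shows "partial_deriv f i x = f' i"
  using assms unfolding partial_deriv_def by (metis frechet_derivative_at)

lemma has_derivative_partial_deriv:
  assumes "f differentiable (at x)"
  shows "(f has_derivative frechet_derivative f (at x)) (at x)"
  using assms by (simp add: frechet_derivative_works)

lemma C_k_Suc_imp: "C_k (Suc k) f \<Longrightarrow> C_k k f"
proof (induction k arbitrary: f)
  case 0
  then show ?case
    by (auto intro!: differentiable_imp_continuous_on simp: differentiable_on_def
        intro: differentiable_at_withinI)
qed auto

lemma C_k_const [simp]: "C_k k (\<lambda>_. c)"
proof (induction k arbitrary: c)
  case (Suc k)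
  have "partial_deriv (\<lambda>_. c) i = (\<lambda>_. 0)" for i :: 'a
    by (rule ext, rule partial_derivI) simp
  with Suc show ?case by simp
qed simp

lemma C_k_scale: "C_k k f \<Longrightarrow> C_k k (\<lambda>x. c * f x)"
proof (induction k arbitrary: f)
  case 0
  then show ?case by (auto intro: continuous_intros)
next
  case (Suc k)
  have "partial_deriv (\<lambda>x. c * f x) i = (\<lambda>x. c * partial_deriv f i x)" for i
    unfolding partial_deriv_def[of f]
    by (rule ext, rule partial_derivI, intro derivative_intros has_derivative_partial_deriv)
       (use Suc.prems in auto)
  with Suc show ?case by auto
qed

lemma C_k_add: "C_k k f \<Longrightarrow> C_k k g \<Longrightarrow> C_k k (\<lambda>x. f x + g x)"
proof (induction k arbitrary: f g)
  case 0
  then show ?case by (auto intro: continuous_intros)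
next
  case (Suc k)
  have "partial_deriv (\<lambda>x. f x + g x) i = (\<lambda>x. partial_deriv f i x + partial_deriv g i x)" for i
    unfolding partial_deriv_def[of f] partial_deriv_def[of g]
    by (rule ext, rule partial_derivI, intro derivative_intros has_derivative_partial_deriv)
       (use Suc.prems in auto)
  with Suc show ?case by auto
qed

lemma C_k_mult: "C_k k f \<Longrightarrow> C_k k g \<Longrightarrow> C_k k (\<lambda>x. f x * g x)"
proof (induction k arbitrary: f g)
  case 0
  then show ?case by (auto intro: continuous_intros)
next
  case (Suc k)
  have "partial_deriv (\<lambda>x. f x * g x) i = (\<lambda>x. f x * partial_deriv g i x + partial_deriv f i x * g x)" for i
    unfolding partial_deriv_def[of f] partial_deriv_def[of g]
    by (rule ext, rule partial_derivI, intro derivative_intros has_derivative_partial_deriv)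
       (use Suc.prems in auto)
  moreover have "C_k k f" "C_k k g"
    using Suc.prems C_k_Suc_imp by blast+
  ultimately show ?case using Suc by (auto intro!: C_k_add)
qed

lemma C_k_prod:
  assumes "finite A" "\<And>i. i \<in> A \<Longrightarrow> C_k k (f i)"
  shows "C_k k (\<lambda>x. \<Prod>i\<in>A. f i x)"
  using assms by (induction A rule: finite_induct) (auto intro: C_k_mult)

section \<open>Reflected functions, which will serve as test functions\<close>

lemma partial_deriv_reflect:
  assumes "f differentiable (at (x - y))"
  shows "partial_deriv (\<lambda>y. f (x - y)) i y = - partial_deriv f i (x - y)"
proof -
  have "((\<lambda>y. f (x - y)) has_derivative (\<lambda>v. frechet_derivative f (at (x - y)) (0 - v))) (at y)"
    using assms by (intro has_derivative_compose[OF _ has_derivative_partial_deriv])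
      (auto intro!: derivative_eq_intros)
  from partial_derivI[OF this, of i] show ?thesis
    using linear_frechet_derivative[OF assms] by (simp add: partial_deriv_def linear_neg)
qed

lemma C_k_reflect: "C_k k f \<Longrightarrow> C_k k (\<lambda>y. f (x - y))"
proof (induction k arbitrary: f)
  case 0
  then show ?case
    by (auto intro!: continuous_intros continuous_on_compose2[of UNIV f])
next
  case (Suc k)
  have "(\<lambda>y. f (x - y)) differentiable (at y)" for y
    by (rule differentiable_compose[of f "\<lambda>y. x - y" y UNIV]) (use Suc.prems in \<open>auto intro!: derivative_intros\<close>)
  moreover have "partial_deriv (\<lambda>y. f (x - y)) i = (\<lambda>y. (- 1) * partial_deriv f i (x - y))" for i
    using partial_deriv_reflect Suc.prems by fastforce
  moreover have "C_k k (\<lambda>y. (- 1) * partial_deriv f i (x - y))" if "i \<in> Basis" for i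
    by (intro C_k_scale Suc.IH) (use that Suc.prems in auto)
  ultimately show ?case
    by (simp del: mult_minus1)
qed

text \<open>The two sign changes of the reflection cancel. Testing with
  \<open>\<lambda>y. \<eta> (z - y)\<close> therefore produces second derivatives of the convolution
  kernel \<open>\<eta>\<close> itself.\<close>

lemma laplacian_reflect:
  assumes "C_k 2 f"
  shows "laplacian (\<lambda>y. f (x - y)) y = laplacian f (x - y)"
proof -
  have 1: "f differentiable (at z)" for z
    using assms by (simp add: numeral_2_eq_2)
  have 2: "partial_deriv f i differentiable (at z)" if "i \<in> Basis" for i z
    using assms that by (simp add: numeral_2_eq_2)
  have "partial_deriv (partial_deriv (\<lambda>y. f (x - y)) i) i y = partial_deriv (partial_deriv f i) i (x - y)"
    if i: "i \<in> Basis" for i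
  proof -
    have "partial_deriv (\<lambda>y. f (x - y)) i = (\<lambda>y. - partial_deriv f i (x - y))"
      by (rule ext, rule partial_deriv_reflect[OF 1])
    moreover have "((\<lambda>y. - partial_deriv f i (x - y)) has_derivative
        (\<lambda>v. - frechet_derivative (partial_deriv f i) (at (x - y)) (0 - v))) (at y)"
      by (intro has_derivative_minus has_derivative_compose[OF _ has_derivative_partial_deriv[OF 2]] i)
        (auto intro!: derivative_eq_intros)
    ultimately show ?thesis
      using linear_frechet_derivative[OF 2[OF i]]
      by (simp add: partial_derivI partial_deriv_def[of "partial_deriv f i"] linear_neg)
  qed
  then show ?thesis unfolding laplacian_def by simp
qed

text \<open>The functions \<open>p(1/t) e\<^sup>-\<^sup>1\<^sup>/\<^sup>t\<close>, \<open>p\<close> a polynomial, are closed under differentiation, so smoothness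
  follows from a single induction over all \<open>p\<close> at once.\<close>

definition exp_recip :: "real poly \<Rightarrow> real \<Rightarrow> real" where
  "exp_recip p t = (if t \<le> 0 then 0 else poly p (1 / t) * exp (- 1 / t))"

lemma poly_times_exp_neg_tendsto_0: "((\<lambda>s. poly p s * exp (- s)) \<longlongrightarrow> (0::real)) at_top"
proof -
  have "((\<lambda>s. \<Sum>i\<le>degree p. coeff p i * (s ^ i / exp s)) \<longlongrightarrow> (\<Sum>i\<le>degree p. coeff p i * 0)) at_top"
    by (intro tendsto_intros tendsto_power_div_exp_0)
  then show ?thesis
    by (simp add: poly_altdef exp_minus divide_inverse sum_distrib_right mult.assoc)
qed

text \<open>Differentiation replaces \<open>p\<close> by \<open>X^2 (p - p')\<close>, and
  \<open>[:0, 0, 1:]\<close> is \<open>X^2\<close>. The delicate point is \<open>t = 0\<close>: the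
  right difference quotient is \<open>s p(s) e^(-s)\<close> with \<open>s = 1/h\<close>, and
  exponential decay wins.\<close>

lemma exp_recip_has_derivative:
  "(exp_recip p has_field_derivative exp_recip ([:0, 0, 1:] * (p - pderiv p)) t) (at t)"
proof (cases "t = 0")
  case False
  show ?thesis
  proof (cases "t < 0")
    case True
    have "((\<lambda>_. 0) has_field_derivative 0) (at t)" by simp
    then have "(exp_recip p has_field_derivative 0) (at t)"
      by (rule has_field_derivative_transform_within[where d = "- t"])
         (use True in \<open>auto simp: exp_recip_def dist_real_def\<close>)
    with True show ?thesis by (simp add: exp_recip_def)
  next
    case False
    with \<open>t \<noteq> 0\<close> have t: "t > 0" by simp
    have "((\<lambda>t. poly p (1 / t) * exp (- 1 / t)) has_field_derivative
        (poly p (1 / t) * (exp (- 1 / t) * (1 / t\<^sup>2)) + poly (pderiv p) (1 / t) * (- 1 / t\<^sup>2) * exp (- 1 / t))) (at t)"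
      using t by (auto intro!: derivative_eq_intros DERIV_chain2[OF poly_DERIV]
          simp: power2_eq_square divide_simps)
    then have "(exp_recip p has_field_derivative
        (poly p (1 / t) * (exp (- 1 / t) * (1 / t\<^sup>2)) + poly (pderiv p) (1 / t) * (- 1 / t\<^sup>2) * exp (- 1 / t))) (at t)"
      by (rule has_field_derivative_transform_within[where d = t])
         (use t in \<open>auto simp: exp_recip_def dist_real_def\<close>)
    moreover have "(poly p (1 / t) * (exp (- 1 / t) * (1 / t\<^sup>2)) + poly (pderiv p) (1 / t) * (- 1 / t\<^sup>2) * exp (- 1 / t))
        = exp_recip ([:0, 0, 1:] * (p - pderiv p)) t"
      using t by (simp add: exp_recip_def field_simps power2_eq_square)
    ultimately show ?thesis by simp
  qed
next
  case True
  have "((\<lambda>s. poly (pCons 0 p) s * exp (- s)) \<longlongrightarrow> 0) at_top"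
    by (rule poly_times_exp_neg_tendsto_0)
  then have "((\<lambda>h. poly (pCons 0 p) (inverse h) * exp (- inverse h)) \<longlongrightarrow> 0) (at_right (0::real))"
    by (rule filterlim_compose[OF _ filterlim_inverse_at_top_right])
  moreover have "eventually (\<lambda>h. poly (pCons 0 p) (inverse h) * exp (- inverse h) = exp_recip p h / h) (at_right 0)"
    unfolding eventually_at_right_field
    by (rule exI[of _ 1]) (auto simp: exp_recip_def field_simps)
  ultimately have "((\<lambda>h. exp_recip p h / h) \<longlongrightarrow> 0) (at_right 0)"
    by (rule Lim_transform_eventually)
  moreover have "((\<lambda>h. exp_recip p h / h) \<longlongrightarrow> 0) (at_left 0)"
    by (rule tendsto_eventually) (auto simp: eventually_at_left_field exp_recip_def intro!: exI[of _ "-1"])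
  ultimately have "((\<lambda>h. exp_recip p h / h) \<longlongrightarrow> 0) (at 0)"
    by (simp add: filterlim_split_at)
  with True show ?thesis by (simp add: DERIV_def exp_recip_def)
qed

lemma C_k_exp_recip_inner: "C_k k (\<lambda>x. exp_recip p (d + x \<bullet> c))"
proof (induction k arbitrary: p)
  case 0
  have "continuous_on UNIV (exp_recip p)"
    using exp_recip_has_derivative by (meson DERIV_isCont continuous_at_imp_continuous_on)
  then show ?case by (auto intro!: continuous_intros continuous_on_compose2[of UNIV "exp_recip p"])
next
  case (Suc k)
  define p' where "p' = [:0, 0, 1:] * (p - pderiv p)"
  have D: "((\<lambda>x. exp_recip p (d + x \<bullet> c)) has_derivative (\<lambda>v. exp_recip p' (d + x \<bullet> c) * (v \<bullet> c))) (at x)" for x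
  proof (rule has_derivative_compose[where g = "exp_recip p" and g' = "(*) (exp_recip p' (d + x \<bullet> c))"])
    show "(exp_recip p has_derivative (*) (exp_recip p' (d + x \<bullet> c))) (at (d + x \<bullet> c))"
      using exp_recip_has_derivative unfolding p'_def has_field_derivative_def .
  qed (auto intro!: derivative_eq_intros)
  have "partial_deriv (\<lambda>x. exp_recip p (d + x \<bullet> c)) i = (\<lambda>x. (i \<bullet> c) * exp_recip p' (d + x \<bullet> c))" for i
    by (rule ext) (simp add: partial_derivI[OF D])
  with D show ?case
    by (auto intro: C_k_scale Suc simp: differentiable_def)
qed

text \<open>A mollifier kernel supported in the cube of half side \<open>\<epsilon>\<close>. As a
  product over coordinates it needs only \<open>exp_recip\<close> composed with affine functions,
  and no smoothness of the norm.\<close>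

definition box_bump :: "real \<Rightarrow> 'a::euclidean_space \<Rightarrow> real" where
  "box_bump \<epsilon> z = (\<Prod>i\<in>Basis. exp_recip 1 (\<epsilon> + z \<bullet> i) * exp_recip 1 (\<epsilon> + z \<bullet> - i))"

lemma C_k_box_bump: "C_k k (box_bump \<epsilon>)"
  unfolding box_bump_def by (intro C_k_prod C_k_mult C_k_exp_recip_inner) simp

lemma box_bump_nonneg: "box_bump \<epsilon> z \<ge> 0"
  unfolding box_bump_def by (intro prod_nonneg) (auto simp: exp_recip_def)

lemma box_bump_even: "box_bump \<epsilon> (- z) = box_bump \<epsilon> z"
  unfolding box_bump_def by (simp add: mult.commute)

lemma box_bump_0_pos: "\<epsilon> > 0 \<Longrightarrow> box_bump \<epsilon> 0 > 0"
  unfolding box_bump_def by (intro prod_pos) (auto simp: exp_recip_def)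

lemma box_bump_nonzeroD:
  fixes z :: "'a::euclidean_space"
  assumes "box_bump \<epsilon> z \<noteq> 0"
  shows "norm z \<le> real DIM('a) * \<epsilon>"
proof -
  have "\<bar>z \<bullet> i\<bar> \<le> \<epsilon>" if "i \<in> Basis" for i
    using assms that unfolding box_bump_def
    by (force simp: exp_recip_def split: if_splits)
  then have "(\<Sum>i\<in>Basis. \<bar>z \<bullet> i\<bar>) \<le> real DIM('a) * \<epsilon>"
    by (rule sum_bounded_above)
  with norm_le_l1[of z] show ?thesis by simp
qed

section \<open>The Laplacian at a touching point\<close>

text \<open>\<open>h'\<close> vanishes at the maximum. If \<open>c\<close> were positive,
  \<open>h'\<close> would be positive just to the right of 0, and the mean value theorem would push
  \<open>h\<close> above \<open>h 0\<close>.\<close>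

lemma second_deriv_nonpos_at_local_max:
  fixes h h' :: "real \<Rightarrow> real"
  assumes "d > 0"
    and h: "\<And>t. \<bar>t\<bar> < d \<Longrightarrow> (h has_field_derivative h' t) (at t)"
    and h': "(h' has_field_derivative c) (at 0)"
    and le: "\<And>t. \<bar>t\<bar> < d \<Longrightarrow> h t \<le> h 0"
  shows "c \<le> 0"
proof (rule ccontr)
  assume "\<not> c \<le> 0"
  with DERIV_pos_inc_right[OF h'] obtain e where e: "e > 0" "\<And>s. 0 < s \<Longrightarrow> s < e \<Longrightarrow> h' 0 < h' s"
    by auto
  have "h' 0 = 0"
    using DERIV_local_max[OF h[of 0] \<open>d > 0\<close>] le \<open>d > 0\<close> by auto
  define s where "s = min d e / 2"
  have s: "0 < s" "s < d" "s < e" using \<open>d > 0\<close> e unfolding s_def by auto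
  have "\<exists>z. z > 0 \<and> z < s \<and> h s - h 0 = (s - 0) * h' z"
    by (rule MVT2) (use s h in auto)
  then obtain z where z: "z > 0" "z < s" "h s - h 0 = s * h' z" by auto
  moreover have "h' z > 0" using e(2)[of z] z s \<open>h' 0 = 0\<close> by auto
  ultimately have "h s - h 0 > 0" using s by simp
  with le[of s] s show False by simp
qed

section \<open>Localisation, convolution and the weak equation on a box\<close>

lemma laplacian_eq_0_on_open:
  assumes "open S" "\<And>x. x \<in> S \<Longrightarrow> f x = 0" "x \<in> S"
  shows "laplacian f x = 0"
proof -
  have loc: "partial_deriv g i y = 0" if "\<And>z. z \<in> S \<Longrightarrow> g z = 0" "y \<in> S" for g :: "'a \<Rightarrow> real" and i y
    by (rule partial_derivI[OF has_derivative_transform_within_open[OF has_derivative_const assms(1) that(2)]])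
      (simp add: that(1))
  have "partial_deriv (partial_deriv f i) i x = 0" for i
    by (intro loc assms)
  then show ?thesis unfolding laplacian_def by simp
qed

text \<open>All derivatives fall on the smooth kernel, so continuity of \<open>u\<close> suffices.
  Applied to \<open>\<eta>\<close> and then to its partial derivative, this gives the second
  derivatives of the convolution along coordinate lines.\<close>

lemma DERIV_convolution_line:
  fixes \<eta> u :: "'a::euclidean_space \<Rightarrow> real"
  assumes u: "continuous_on (cbox a b) u"
    and diff: "\<And>z. \<eta> differentiable (at z)"
    and cont: "continuous_on UNIV (partial_deriv \<eta> i)"
  shows "((\<lambda>t. integral (cbox a b) (\<lambda>y. u y * \<eta> (x + t *\<^sub>R i - y))) has_field_derivative
           integral (cbox a b) (\<lambda>y. u y * partial_deriv \<eta> i (x + t *\<^sub>R i - y))) (at t)"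
proof (rule leibniz_rule_field_derivative[where U = UNIV])
  have c\<eta>: "continuous_on UNIV \<eta>"
    by (intro differentiable_imp_continuous_on) (auto simp: differentiable_on_def diff intro: differentiable_at_withinI)
  show "(\<lambda>y. u y * \<eta> (x + t *\<^sub>R i - y)) integrable_on cbox a b" for t
    by (intro integrable_continuous continuous_intros u continuous_on_compose2[OF c\<eta>]) auto
  show "continuous_on (UNIV \<times> cbox a b) (\<lambda>(t, y). u y * partial_deriv \<eta> i (x + t *\<^sub>R i - y))"
    unfolding split_beta
    by (intro continuous_intros continuous_on_compose2[OF u] continuous_on_compose2[OF cont]) auto
  show "((\<lambda>t. u y * \<eta> (x + t *\<^sub>R i - y)) has_field_derivative u y * partial_deriv \<eta> i (x + t *\<^sub>R i - y)) (at t)" for t y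
  proof -
    let ?z = "x + t *\<^sub>R i - y"
    have "((\<lambda>t. \<eta> (x + t *\<^sub>R i - y)) has_derivative (\<lambda>s. frechet_derivative \<eta> (at ?z) (s *\<^sub>R i))) (at t)"
      by (rule has_derivative_compose[OF _ has_derivative_partial_deriv[OF diff]])
        (auto intro!: derivative_eq_intros)
    moreover have "frechet_derivative \<eta> (at ?z) (s *\<^sub>R i) = partial_deriv \<eta> i ?z * s" for s
      using linear_frechet_derivative[OF diff] by (simp add: linear_scale partial_deriv_def)
    ultimately have "((\<lambda>t. \<eta> (x + t *\<^sub>R i - y)) has_field_derivative partial_deriv \<eta> i ?z) (at t)"
      by (simp add: has_field_derivative_def)
    then show ?thesis by (rule DERIV_cmult)
  qed
qed auto

lemma set_integrable_cbox_continuous: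
  fixes g :: "'a::euclidean_space \<Rightarrow> real"
  assumes "continuous_on (cbox a b) g"
  shows "set_integrable lborel (cbox a b) g"
  unfolding set_integrable_def by (rule borel_integrable_compact[OF compact_cbox assms])

text \<open>Evenness turns \<open>\<eta> (z - y)\<close> into the translate
  \<open>\<eta> (y - z)\<close>, so by translation invariance the mass of the kernel does not depend
  on its centre while the box contains its support.\<close>

lemma integral_even_reflected:
  fixes \<eta> :: "'a::euclidean_space \<Rightarrow> real"
  assumes cont: "continuous_on UNIV \<eta>" and even: "\<And>z. \<eta> (- z) = \<eta> z"
    and supp: "\<And>y. \<eta> (z - y) \<noteq> 0 \<Longrightarrow> y \<in> cbox a b"
  shows "integral (cbox a b) (\<lambda>y. \<eta> (z - y)) = (LINT y|lborel. \<eta> y)"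
proof -
  have c: "continuous_on (cbox a b) (\<lambda>y. \<eta> (z - y))"
    by (intro continuous_intros continuous_on_compose2[OF cont]) auto
  have "integral (cbox a b) (\<lambda>y. \<eta> (z - y)) = (LINT y:cbox a b|lborel. \<eta> (z - y))"
    by (intro set_borel_integral_eq_integral(2)[symmetric] set_integrable_cbox_continuous c)
  also have "\<dots> = (LINT y|lborel. \<eta> (z - y))"
    unfolding set_lebesgue_integral_def using supp
    by (intro Bochner_Integration.integral_cong) (auto simp: indicator_def)
  also have "\<dots> = (LINT y|lborel. \<eta> (- z + y))"
    by (intro Bochner_Integration.integral_cong refl) (metis even add.commute minus_diff_eq uminus_add_conv_diff)
  also have "\<dots> = integral\<^sup>L (distr lborel borel ((+) (- z))) \<eta>"
    using cont by (subst integral_distr) (auto intro: borel_measurable_continuous_onI)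
  finally show ?thesis by (simp add: lborel_distr_plus)
qed

text \<open>Replaces the Lebesgue integral over \<open>\<Omega>\<close> by an integral over a box on
  which all factors are continuous. There both terms are integrable separately, so the weak equation
  can be split.\<close>

lemma weak_identity_on_cbox:
  fixes \<phi> u f :: "'a::euclidean_space \<Rightarrow> real"
  assumes \<phi>: "\<And>k. C_k k \<phi>"
    and supp: "\<And>x. \<phi> x \<noteq> 0 \<Longrightarrow> x \<in> K" and K: "closed K" "K \<subseteq> cbox a b" "cbox a b \<subseteq> \<Omega>"
    and u: "continuous_on (cbox a b) u" and f: "continuous_on (cbox a b) f"
    and weak: "\<And>\<phi>. test_function \<Omega> \<phi> \<Longrightarrow> (LINT x:\<Omega>|lborel. u x * laplacian \<phi> x - f x * \<phi> x) = 0"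
  shows "integral (cbox a b) (\<lambda>x. u x * laplacian \<phi> x) = integral (cbox a b) (\<lambda>x. f x * \<phi> x)"
proof -
  have cl: "closure {x. \<phi> x \<noteq> 0} \<subseteq> K"
    using supp K(1) by (intro closure_minimal) auto
  have "compact (closure {x. \<phi> x \<noteq> 0})"
    using cl K by (metis bounded_cbox bounded_subset closed_closure compact_eq_bounded_closed)
  with \<phi> cl K have "test_function \<Omega> \<phi>" unfolding test_function_def by blast
  from weak[OF this] have 0: "(LINT x:\<Omega>|lborel. u x * laplacian \<phi> x - f x * \<phi> x) = 0" .
  \<comment> \<open>The complement of \<open>K\<close> is open and \<open>\<phi>\<close> vanishes on
    it, hence so does its Laplacian.\<close>
  have out: "u x * laplacian \<phi> x - f x * \<phi> x = 0" if "x \<notin> cbox a b" for x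
  proof -
    have "\<phi> y = 0" if "y \<in> - K" for y using supp that by auto
    moreover have "x \<in> - K" using that K by auto
    moreover have "open (- K)" using K by auto
    ultimately show ?thesis using laplacian_eq_0_on_open[of "- K" \<phi> x] by simp
  qed
  have "continuous_on UNIV \<phi>" using \<phi>[of 0] by simp
  then have c\<phi>: "continuous_on (cbox a b) \<phi>" by (rule continuous_on_subset) auto
  have "continuous_on UNIV (laplacian \<phi>)"
    unfolding laplacian_def[abs_def] using \<phi>[of 2] by (auto intro!: continuous_intros simp: numeral_2_eq_2)
  then have c\<phi>2: "continuous_on (cbox a b) (laplacian \<phi>)" by (rule continuous_on_subset) auto
  have "(LINT x:\<Omega>|lborel. u x * laplacian \<phi> x - f x * \<phi> x) = (LINT x:cbox a b|lborel. u x * laplacian \<phi> x - f x * \<phi> x)"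
    unfolding set_lebesgue_integral_def using out K(3)
    by (intro Bochner_Integration.integral_cong refl) (auto simp: indicator_def)
  also have "\<dots> = integral (cbox a b) (\<lambda>x. u x * laplacian \<phi> x - f x * \<phi> x)"
    by (intro set_borel_integral_eq_integral(2) set_integrable_cbox_continuous continuous_intros u f c\<phi> c\<phi>2)
  also have "\<dots> = integral (cbox a b) (\<lambda>x. u x * laplacian \<phi> x) - integral (cbox a b) (\<lambda>x. f x * \<phi> x)"
    by (intro integral_diff integrable_continuous continuous_intros u f c\<phi> c\<phi>2)
  finally show ?thesis using 0 by simp
qed

text \<open>Since \<open>u\<close> has no second derivatives, it is mollified; \<open>\<psi>\<close> is not, so no integration by parts is
  needed. The correction \<open>\<kappa> |x - x0|\<^sup>2\<close> makes the maximum strict, so that it survives the mollification.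
  The mollifier keeps its mass \<open>M\<close> instead of being normalised.\<close>

lemma laplacian_at_touching_above:
  fixes u f \<psi> :: "'a::euclidean_space \<Rightarrow> real"
  assumes u: "continuous_on \<Omega> u" and f: "continuous_on \<Omega> f"
    and weak: "\<And>\<phi>. test_function \<Omega> \<phi> \<Longrightarrow> (LINT x:\<Omega>|lborel. u x * laplacian \<phi> x - f x * \<phi> x) = 0"
    and r: "r > 0" "ball x0 r \<subseteq> \<Omega>"
    and \<psi>1: "\<And>x i. x \<in> ball x0 r \<Longrightarrow> i \<in> Basis \<Longrightarrow> ((\<lambda>t. \<psi> (x + t *\<^sub>R i)) has_field_derivative \<psi>1 i x) (at 0)"
    and \<psi>2: "\<And>x i. x \<in> ball x0 r \<Longrightarrow> i \<in> Basis \<Longrightarrow> ((\<lambda>t. \<psi>1 i (x + t *\<^sub>R i)) has_field_derivative \<psi>2 i x) (at 0)"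
    and \<psi>c: "continuous_on (ball x0 r) \<psi>" and \<psi>2c: "isCont (\<lambda>x. \<Sum>i\<in>Basis. \<psi>2 i x) x0"
    and max: "\<And>x. x \<in> ball x0 r \<Longrightarrow> u x - \<psi> x \<le> u x0 - \<psi> x0"
  shows "f x0 \<le> (\<Sum>i\<in>Basis. \<psi>2 i x0)"
proof (rule ccontr)
  define L where "L = (\<lambda>x. \<Sum>i\<in>Basis. \<psi>2 i x)"
  assume neg: "\<not> f x0 \<le> (\<Sum>i\<in>Basis. \<psi>2 i x0)"
  define d where "d = f x0 - L x0"
  have d: "d > 0" using neg unfolding d_def L_def by simp
  define n where "n = real DIM('a)"
  have n: "n > 0" unfolding n_def by simp
  \<comment> \<open>The penalty adds \<open>2 * \<kappa> * n = d / 4\<close> to the Laplacian of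
    \<open>\<psi>\<close>. The oscillations of \<open>L\<close> and \<open>f\<close> near
    \<open>x0\<close> cost at most another \<open>d / 4\<close> each, so a quarter of the gap
    \<open>d\<close> remains for the contradiction.\<close>
  define \<kappa> where "\<kappa> = d / (8 * n)"
  have \<kappa>: "\<kappa> > 0" "2 * \<kappa> * n = d / 4" using d n unfolding \<kappa>_def by auto
  obtain a b where ab: "cbox a b \<subseteq> ball x0 r" "x0 \<in> box a b"
    using open_contains_cbox[of "ball x0 r" x0] r(1) by (metis centre_in_ball open_ball)
  have uQ: "continuous_on (cbox a b) u" and fQ: "continuous_on (cbox a b) f"
    using u f ab r by (meson continuous_on_subset order_trans)+
  have "isCont f x0"
    by (rule continuous_on_interior[OF fQ]) (use ab(2) in \<open>simp add: interior_cbox\<close>)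
  then have "\<exists>\<rho>>0. \<forall>y. dist y x0 < \<rho> \<longrightarrow> dist (f y) (f x0) < d / 4"
    unfolding continuous_at_eps_delta using d by (meson divide_pos_pos zero_less_numeral)
  then obtain R1 where R1: "R1 > 0" "\<And>y. dist y x0 < R1 \<Longrightarrow> \<bar>f y - f x0\<bar> < d / 4"
    unfolding dist_real_def by blast
  have "\<exists>\<rho>>0. \<forall>y. dist y x0 < \<rho> \<longrightarrow> dist (L y) (L x0) < d / 4"
    using \<psi>2c unfolding L_def[symmetric] continuous_at_eps_delta using d by (meson divide_pos_pos zero_less_numeral)
  then obtain R2 where R2: "R2 > 0" "\<And>y. dist y x0 < R2 \<Longrightarrow> \<bar>L y - L x0\<bar> < d / 4"
    unfolding dist_real_def by blast
  obtain R3 where R3: "R3 > 0" "cball x0 R3 \<subseteq> box a b"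
    using ab(2) open_box open_contains_cball by blast
  define R where "R = min (min R1 R2) R3 / 2"
  have R: "R > 0" "R < R1" "R < R2" "R \<le> R3" using R1 R2 R3 unfolding R_def by auto
  have RQ: "cball x0 R \<subseteq> cbox a b" using R R3 box_subset_cbox by (force simp: subset_iff)
  \<comment> \<open>\<open>\<tau>\<close> will bound the mollification error per unit mass. On the
    sphere of radius \<open>R / 2\<close> the penalty equals \<open>4 * \<tau>\<close>.\<close>
  define \<tau> where "\<tau> = \<kappa> * R\<^sup>2 / 16"
  have \<tau>: "\<tau> > 0" using \<kappa> R unfolding \<tau>_def by simp
  have "uniformly_continuous_on (cball x0 R) u"
    by (intro compact_uniformly_continuous continuous_on_subset[OF uQ] RQ) auto
  then obtain \<delta> where \<delta>: "\<delta> > 0" "\<And>x y. x \<in> cball x0 R \<Longrightarrow> y \<in> cball x0 R \<Longrightarrow> dist x y < \<delta> \<Longrightarrow> \<bar>u x - u y\<bar> < \<tau>"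
    unfolding uniformly_continuous_on_def dist_real_def using \<tau> by metis
  \<comment> \<open>The kernel lives in a ball of radius \<open>n * \<epsilon>\<close>: less than
    \<open>\<delta>\<close> for the uniform continuity of \<open>u\<close>, and at most
    \<open>R / 2\<close> so that kernels centred in \<open>cball x0 (R / 2)\<close> stay inside
    \<open>cball x0 R\<close>.\<close>
  define \<epsilon> where "\<epsilon> = min (\<delta> / 2) (R / 2) / n"
  have \<epsilon>: "\<epsilon> > 0" "n * \<epsilon> < \<delta>" "n * \<epsilon> \<le> R / 2" using \<delta> R n unfolding \<epsilon>_def by (auto simp: field_simps)
  define \<eta> where "\<eta> = (box_bump \<epsilon> :: 'a \<Rightarrow> real)"
  have \<eta>C: "C_k k \<eta>" for k unfolding \<eta>_def by (rule C_k_box_bump)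
  have \<eta>0: "\<eta> z \<ge> 0" for z unfolding \<eta>_def by (rule box_bump_nonneg)
  have \<eta>s: "norm z \<le> n * \<epsilon>" if "\<eta> z \<noteq> 0" for z
    using box_bump_nonzeroD that unfolding \<eta>_def n_def by blast
  have \<eta>c: "continuous_on UNIV \<eta>" using \<eta>C[of 0] by simp
  have \<eta>r: "continuous_on A (\<lambda>y. \<eta> (z - y))" for z A
    by (intro continuous_intros continuous_on_compose2[OF \<eta>c]) auto
  define C where "C = cball x0 (R / 2)"
  have C: "compact C" "C \<noteq> {}" "x0 \<in> C" using R unfolding C_def by auto
  have near: "y \<in> cball x0 R" "dist z y < \<delta>" if "z \<in> C" "\<eta> (z - y) \<noteq> 0" for z y
  proof -
    have "dist z y \<le> n * \<epsilon>" using \<eta>s[OF that(2)] by (simp add: dist_norm)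
    with \<epsilon> that(1) dist_triangle[of x0 y z] show "y \<in> cball x0 R" "dist z y < \<delta>" unfolding C_def by auto
  qed
  define M where "M = (LINT y|lborel. \<eta> y)"
  have M: "integral (cbox a b) (\<lambda>y. \<eta> (z - y)) = M" if "z \<in> C" for z
    unfolding M_def
    by (rule integral_even_reflected[OF \<eta>c]) (use near that RQ in \<open>auto simp: \<eta>_def box_bump_even\<close>)
  have Mint: "(\<lambda>y. \<eta> (z - y)) integrable_on cbox a b" for z
    by (intro integrable_continuous \<eta>r)
  have "M \<ge> 0" using M[OF C(3)] integral_nonneg[OF Mint] \<eta>0 by metis
  moreover have "M \<noteq> 0"
  proof
    assume "M = 0"
    then have "((\<lambda>y. \<eta> (x0 - y)) has_integral 0) (cbox a b)"
      using M[OF C(3)] Mint[of x0] by (simp add: has_integral_integral)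
    from has_integral_0_cbox_imp_0[OF \<eta>r _ this, of x0] \<eta>0 ab(2) box_subset_cbox[of a b]
    have "\<eta> 0 = 0" by auto
    then show False using box_bump_0_pos[OF \<epsilon>(1), where 'a = 'a] unfolding \<eta>_def by simp
  qed
  ultimately have Mpos: "M > 0" by simp
  define U where "U = (\<lambda>z. integral (cbox a b) (\<lambda>y. u y * \<eta> (z - y)))"
  have U_close: "\<bar>U z - M * u z\<bar> \<le> \<tau> * M" if z: "z \<in> C" for z
  proof -
    have i1: "(\<lambda>y. u y * \<eta> (z - y)) integrable_on cbox a b"
      by (intro integrable_continuous continuous_intros uQ \<eta>r)
    have i2: "(\<lambda>y. u z * \<eta> (z - y)) integrable_on cbox a b"
      by (intro integrable_continuous continuous_intros \<eta>r)
    have "U z - M * u z = integral (cbox a b) (\<lambda>y. u y * \<eta> (z - y) - u z * \<eta> (z - y))"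
      using M[OF z] by (simp add: U_def integral_diff[OF i1 i2])
    moreover have "norm \<dots> \<le> integral (cbox a b) (\<lambda>y. \<tau> * \<eta> (z - y))"
    proof (rule integral_norm_bound_integral)
      show "norm (u y * \<eta> (z - y) - u z * \<eta> (z - y)) \<le> \<tau> * \<eta> (z - y)" for y
      proof (cases "\<eta> (z - y) = 0")
        case False
        have "\<bar>u z - u y\<bar> < \<tau>"
          using near[OF z False] z R by (intro \<delta>) (auto simp: C_def)
        then have "\<bar>u y - u z\<bar> * \<eta> (z - y) \<le> \<tau> * \<eta> (z - y)"
          using \<eta>0 by (intro mult_right_mono) auto
        then show ?thesis using \<eta>0[of "z - y"] by (simp add: abs_mult flip: left_diff_distrib)
      qed simp
    qed (intro integrable_diff i1 i2 integrable_continuous continuous_intros \<eta>r)+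
    ultimately show ?thesis using M[OF z] by simp
  qed
  define \<psi>' where "\<psi>' = (\<lambda>x. \<psi> x + \<kappa> * (norm (x - x0))\<^sup>2)"
  define H where "H = (\<lambda>z. U z - M * \<psi>' z)"
  have Cr: "C \<subseteq> ball x0 r" using RQ ab R unfolding C_def by (force simp: subset_iff)
  have "continuous_on UNIV U"
    unfolding U_def
    by (rule integral_continuous_on_param)
      (auto simp: split_beta intro!: continuous_intros continuous_on_compose2[OF uQ] continuous_on_compose2[OF \<eta>c])
  then have "continuous_on C H"
    unfolding H_def \<psi>'_def using \<psi>c Cr by (auto intro!: continuous_intros intro: continuous_on_subset)
  then obtain z where z: "z \<in> C" "\<And>y. y \<in> C \<Longrightarrow> H y \<le> H z"
    using continuous_attains_sup[OF C(1,2)] by blast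
  \<comment> \<open>On the boundary sphere the penalty \<open>4 * \<tau>\<close> beats the
    mollification errors, \<open>\<tau>\<close> at \<open>z\<close> and \<open>\<tau>\<close> at
    \<open>x0\<close>, so the maximum of \<open>H\<close> is attained in the interior.\<close>
  have "dist x0 z \<noteq> R / 2"
  proof
    assume *: "dist x0 z = R / 2"
    then have nz: "norm (z - x0) = R / 2" by (simp add: dist_norm norm_minus_commute)
    have "H x0 \<ge> M * (u x0 - \<psi> x0 - \<tau>)"
      using U_close[OF C(3)] unfolding H_def \<psi>'_def by (simp add: algebra_simps)
    moreover have "H z \<le> M * (u z - \<psi> z - \<kappa> * (R / 2)\<^sup>2 + \<tau>)"
      using U_close[OF z(1)] unfolding H_def \<psi>'_def nz by (simp add: algebra_simps)
    moreover have "M * (u z - \<psi> z - \<kappa> * (R / 2)\<^sup>2 + \<tau>) < M * (u x0 - \<psi> x0 - \<tau>)"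
    proof (intro mult_strict_left_mono Mpos)
      have "\<kappa> * (R / 2)\<^sup>2 = 4 * \<tau>" unfolding \<tau>_def by (simp add: field_simps)
      with max[of z] z(1) Cr \<tau> show "u z - \<psi> z - \<kappa> * (R / 2)\<^sup>2 + \<tau> < u x0 - \<psi> x0 - \<tau>" by auto
    qed
    ultimately show False using z(2)[OF C(3)] by linarith
  qed
  with z(1) have "z \<in> ball x0 (R / 2)" unfolding C_def by auto
  then obtain e where e: "e > 0" "ball z e \<subseteq> ball x0 (R / 2)"
    using open_ball open_contains_ball by blast
  then have eC: "ball z e \<subseteq> C" unfolding C_def by force
  have diff: "\<eta> differentiable (at y)" for y using \<eta>C[of 1] by simp
  have c1: "continuous_on UNIV (partial_deriv \<eta> i)" if "i \<in> Basis" for i using \<eta>C[of 1] that by simp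
  have diff1: "partial_deriv \<eta> i differentiable (at y)" if "i \<in> Basis" for y i
    using \<eta>C[of 2] that by (simp add: numeral_2_eq_2)
  have c2: "continuous_on UNIV (partial_deriv (partial_deriv \<eta> i) i)" if "i \<in> Basis" for i
    using \<eta>C[of 2] that by (simp add: numeral_2_eq_2)
  \<comment> \<open>At the interior maximum \<open>z\<close> of \<open>H\<close> each pure second
    derivative of \<open>U\<close> is at most that of \<open>M * \<psi>'\<close>.\<close>
  have second: "integral (cbox a b) (\<lambda>y. u y * partial_deriv (partial_deriv \<eta> i) i (z - y)) \<le> M * (\<psi>2 i z + 2 * \<kappa>)"
    if i: "i \<in> Basis" for i
  proof -
    have line: "z + t *\<^sub>R i \<in> C" "z + t *\<^sub>R i \<in> ball x0 r" if "\<bar>t\<bar> < e" for t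
    proof -
      have "z + t *\<^sub>R i \<in> ball z e" using that i by (simp add: dist_norm)
      then show "z + t *\<^sub>R i \<in> C" "z + t *\<^sub>R i \<in> ball x0 r" using eC Cr by blast+
    qed
    have sq: "(norm (z + t *\<^sub>R i - x0))\<^sup>2 = (norm (z - x0))\<^sup>2 + 2 * t * ((z - x0) \<bullet> i) + t\<^sup>2" for t
    proof -
      have "z + t *\<^sub>R i - x0 = (z - x0) + t *\<^sub>R i" by simp
      then show ?thesis using i
        by (simp only: power2_norm_eq_inner)
          (simp add: inner_add_left inner_add_right inner_commute power2_eq_square algebra_simps)
    qed
    define h' where "h' = (\<lambda>t. integral (cbox a b) (\<lambda>y. u y * partial_deriv \<eta> i (z + t *\<^sub>R i - y))
        - M * (\<psi>1 i (z + t *\<^sub>R i) + \<kappa> * (2 * ((z - x0) \<bullet> i) + 2 * t)))"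
    have "integral (cbox a b) (\<lambda>y. u y * partial_deriv (partial_deriv \<eta> i) i (z + 0 *\<^sub>R i - y)) - M * (\<psi>2 i z + \<kappa> * 2) \<le> 0"
    proof (rule second_deriv_nonpos_at_local_max[OF e(1), where h = "\<lambda>t. H (z + t *\<^sub>R i)" and h' = h'])
      fix t :: real assume t: "\<bar>t\<bar> < e"
      have "((\<lambda>s. \<psi> (z + t *\<^sub>R i + s *\<^sub>R i)) has_field_derivative \<psi>1 i (z + t *\<^sub>R i)) (at 0)"
        using \<psi>1[OF line(2)[OF t] i] .
      then have "((\<lambda>s. \<psi> (z + (s + t) *\<^sub>R i)) has_field_derivative \<psi>1 i (z + t *\<^sub>R i)) (at 0)"
        by (simp add: scaleR_add_left add_ac)
      then have "((\<lambda>s. \<psi> (z + s *\<^sub>R i)) has_field_derivative \<psi>1 i (z + t *\<^sub>R i)) (at t)"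
        using DERIV_shift[of "\<lambda>s. \<psi> (z + s *\<^sub>R i)" _ 0 t] by simp
      then show "((\<lambda>t. H (z + t *\<^sub>R i)) has_field_derivative h' t) (at t)"
        unfolding H_def U_def h'_def \<psi>'_def sq
        by (auto intro!: derivative_eq_intros DERIV_convolution_line[OF uQ diff c1[OF i], THEN DERIV_cong] simp: algebra_simps)
      show "H (z + t *\<^sub>R i) \<le> H (z + 0 *\<^sub>R i)" using z(2) line(1)[OF t] by simp
    next
      show "(h' has_field_derivative integral (cbox a b) (\<lambda>y. u y * partial_deriv (partial_deriv \<eta> i) i (z + 0 *\<^sub>R i - y)) - M * (\<psi>2 i z + \<kappa> * 2)) (at 0)"
        unfolding h'_def
        by (intro DERIV_diff DERIV_cmult DERIV_add DERIV_convolution_line[OF uQ diff1[OF i] c2[OF i]] \<psi>2 i)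
          (use line(2)[of 0] e in \<open>auto intro!: derivative_eq_intros\<close>)
    qed
    then show ?thesis by (simp add: algebra_simps)
  qed
  \<comment> \<open>The weak equation tested with the kernel centred at \<open>z\<close> turns the
    Laplacian of \<open>U\<close> at \<open>z\<close> into a weighted integral of \<open>f\<close>
    near \<open>x0\<close>, which is too large for the bound just found.\<close>
  define \<phi> where "\<phi> = (\<lambda>y. \<eta> (z - y))"
  have "integral (cbox a b) (\<lambda>y. u y * laplacian \<phi> y) = (\<Sum>i\<in>Basis. integral (cbox a b) (\<lambda>y. u y * partial_deriv (partial_deriv \<eta> i) i (z - y)))"
    unfolding \<phi>_def laplacian_reflect[OF \<eta>C] unfolding laplacian_def sum_distrib_left
    by (intro integral_sum integrable_continuous continuous_intros uQ continuous_on_compose2[OF c2]) auto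
  also have "\<dots> \<le> (\<Sum>i\<in>Basis. M * (\<psi>2 i z + 2 * \<kappa>))"
    by (intro sum_mono second)
  also have "\<dots> = M * (L z + d / 4)"
    unfolding L_def \<kappa>(2)[symmetric] n_def by (simp add: sum.distrib sum_distrib_left algebra_simps)
  also have "\<dots> < M * (f x0 - d / 4)"
  proof (intro mult_strict_left_mono Mpos)
    have "\<bar>L z - L x0\<bar> < d / 4"
      using z(1) R by (intro R2(2)) (auto simp: C_def dist_commute)
    then show "L z + d / 4 < f x0 - d / 4" using d d_def by linarith
  qed
  also have "\<dots> = integral (cbox a b) (\<lambda>y. (f x0 - d / 4) * \<phi> y)"
    using M[OF z(1)] unfolding \<phi>_def by simp
  also have "\<dots> \<le> integral (cbox a b) (\<lambda>y. f y * \<phi> y)"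
  proof (rule integral_le)
    fix y
    show "(f x0 - d / 4) * \<phi> y \<le> f y * \<phi> y"
    proof (cases "\<phi> y = 0")
      case False
      then have "dist y x0 < R1" using near(1)[of z y] z(1) R unfolding \<phi>_def by (auto simp: dist_commute)
      then have "f x0 - d / 4 \<le> f y" using R1(2)[of y] by linarith
      then show ?thesis using \<eta>0 unfolding \<phi>_def by (intro mult_right_mono)
    qed simp
  qed (auto simp: \<phi>_def intro!: integrable_continuous continuous_intros fQ \<eta>r)
  also have "\<dots> = integral (cbox a b) (\<lambda>y. u y * laplacian \<phi> y)"
  proof (rule weak_identity_on_cbox[symmetric, where K = "cball x0 R" and \<Omega> = \<Omega>])
    show "C_k k \<phi>" for k unfolding \<phi>_def by (intro C_k_reflect \<eta>C)
    show "y \<in> cball x0 R" if "\<phi> y \<noteq> 0" for y using near(1)[OF z(1)] that unfolding \<phi>_def by blast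
  qed (use RQ ab r uQ fQ weak in auto)
  finally show False by simp
qed

text \<open>The profile depends on \<open>s = |x - y|^2\<close>, a polynomial in \<open>x\<close>,
  so touching at the centre \<open>y\<close> is covered too. In the plane the Laplacian of
  \<open>P(s)\<close> is \<open>4 P' + 4 s P''\<close>. The gradients agree because
  \<open>u - P(s)\<close> has a local maximum at \<open>x0\<close>.\<close>

lemma radial_touching_above:
  fixes u f :: "real^2 \<Rightarrow> real"
  assumes u: "continuous_on \<Omega> u" and f: "continuous_on \<Omega> f" and "open \<Omega>" "x0 \<in> \<Omega>"
    and weak: "\<And>\<phi>. test_function \<Omega> \<phi> \<Longrightarrow> (LINT x:\<Omega>|lborel. u x * laplacian \<phi> x - f x * \<phi> x) = 0"
    and g: "GDERIV u x0 :> g"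
    and S: "open S" "(norm (x0 - y))\<^sup>2 \<in> S"
    and P1: "\<And>s. s \<in> S \<Longrightarrow> (P has_field_derivative P1 s) (at s)"
    and P2: "\<And>s. s \<in> S \<Longrightarrow> (P1 has_field_derivative P2 s) (at s)" "continuous_on S P2"
    and max: "eventually (\<lambda>x. u x - P ((norm (x - y))\<^sup>2) \<le> u x0 - P ((norm (x0 - y))\<^sup>2)) (nhds x0)"
  shows "f x0 \<le> 4 * P1 ((norm (x0 - y))\<^sup>2) + 4 * (norm (x0 - y))\<^sup>2 * P2 ((norm (x0 - y))\<^sup>2)"
    and "g = (2 * P1 ((norm (x0 - y))\<^sup>2)) *\<^sub>R (x0 - y)"
proof -
  define \<sigma> where "\<sigma> = (\<lambda>x::real^2. (norm (x - y))\<^sup>2)"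
  have \<sigma>c: "continuous_on A \<sigma>" for A unfolding \<sigma>_def by (intro continuous_intros)
  have "eventually (\<lambda>x. x \<in> \<Omega> \<and> \<sigma> x \<in> S \<and> u x - P (\<sigma> x) \<le> u x0 - P (\<sigma> x0)) (nhds x0)"
  proof (intro eventually_conj)
    show "eventually (\<lambda>x. x \<in> \<Omega>) (nhds x0)" using \<open>open \<Omega>\<close> \<open>x0 \<in> \<Omega>\<close> eventually_nhds by blast
    have "open (\<sigma> -` S)" using \<sigma>c[of UNIV] S(1) by (simp add: continuous_on_open_vimage open_vimage)
    then show "eventually (\<lambda>x. \<sigma> x \<in> S) (nhds x0)"
      using S(2) unfolding eventually_nhds \<sigma>_def by blast
  qed (use max in \<open>simp add: \<sigma>_def\<close>)
  then obtain r where r: "r > 0" "\<And>x. x \<in> ball x0 r \<Longrightarrow> x \<in> \<Omega> \<and> \<sigma> x \<in> S \<and> u x - P (\<sigma> x) \<le> u x0 - P (\<sigma> x0)"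
    unfolding eventually_nhds_metric by (auto simp: dist_commute)
  have Pc: "continuous_on S P" and P1c: "continuous_on S P1"
    using P1 P2(1) DERIV_isCont continuous_at_imp_continuous_on by blast+
  define \<psi>1 where "\<psi>1 = (\<lambda>(i::real^2) x. P1 (\<sigma> x) * (2 * ((x - y) \<bullet> i)))"
  define \<psi>2 where "\<psi>2 = (\<lambda>(i::real^2) x. P2 (\<sigma> x) * (2 * ((x - y) \<bullet> i))\<^sup>2 + P1 (\<sigma> x) * 2)"
  have sq: "\<sigma> (x + t *\<^sub>R i) = \<sigma> x + 2 * t * ((x - y) \<bullet> i) + t\<^sup>2" if "i \<in> Basis" for x i t
  proof -
    have "x + t *\<^sub>R i - y = (x - y) + t *\<^sub>R i" by simp
    then show ?thesis using that unfolding \<sigma>_def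
      by (simp only: power2_norm_eq_inner)
        (simp add: inner_add_left inner_add_right inner_commute power2_eq_square algebra_simps)
  qed
  have \<sigma>1: "((\<lambda>t. \<sigma> (x + t *\<^sub>R i)) has_field_derivative 2 * ((x - y) \<bullet> i)) (at 0)" if "i \<in> Basis" for x i
    unfolding sq[OF that] by (auto intro!: derivative_eq_intros)
  have chain: "((\<lambda>t. F (\<sigma> (x + t *\<^sub>R i))) has_field_derivative F' * (2 * ((x - y) \<bullet> i))) (at 0)"
    if "i \<in> Basis" "(F has_field_derivative F') (at (\<sigma> x))" for F F' x i
    using DERIV_chain2[of F F' "\<lambda>t. \<sigma> (x + t *\<^sub>R i)" 0, OF _ \<sigma>1[OF that(1)]] that(2) by simp
  have L: "(\<Sum>i\<in>Basis. \<psi>2 i x) = 4 * P1 (\<sigma> x) + 4 * \<sigma> x * P2 (\<sigma> x)" for x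
  proof -
    have "(\<Sum>i\<in>Basis. ((x - y) \<bullet> i)\<^sup>2) = \<sigma> x"
      unfolding \<sigma>_def power2_norm_eq_inner by (simp add: euclidean_inner[of "x - y" "x - y"] power2_eq_square)
    then have "(\<Sum>i\<in>Basis. P2 (\<sigma> x) * (2 * ((x - y) \<bullet> i))\<^sup>2) = 4 * \<sigma> x * P2 (\<sigma> x)"
      by (simp add: power_mult_distrib flip: sum_distrib_left)
    then show ?thesis unfolding \<psi>2_def by (simp add: sum.distrib)
  qed
  have "f x0 \<le> (\<Sum>i\<in>Basis. \<psi>2 i x0)"
  proof (rule laplacian_at_touching_above[OF u f weak r(1), where \<psi> = "\<lambda>x. P (\<sigma> x)" and ?\<psi>1.0 = \<psi>1])
    show "ball x0 r \<subseteq> \<Omega>" using r(2) by blast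
    show "((\<lambda>t. P (\<sigma> (x + t *\<^sub>R i))) has_field_derivative \<psi>1 i x) (at 0)" if "x \<in> ball x0 r" "i \<in> Basis" for x i
      unfolding \<psi>1_def using that r(2) by (intro chain P1) auto
    show "((\<lambda>t. \<psi>1 i (x + t *\<^sub>R i)) has_field_derivative \<psi>2 i x) (at 0)" if "x \<in> ball x0 r" "i \<in> Basis" for x i
    proof -
      have "((\<lambda>t. P1 (\<sigma> (x + t *\<^sub>R i))) has_field_derivative P2 (\<sigma> x) * (2 * ((x - y) \<bullet> i))) (at 0)"
        using that r(2) by (intro chain P2) auto
      moreover have "((\<lambda>t. 2 * ((x + t *\<^sub>R i - y) \<bullet> i)) has_field_derivative 2) (at 0)"
        using that by (auto intro!: derivative_eq_intros simp: inner_add_left inner_diff_left)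
      ultimately show ?thesis
        unfolding \<psi>1_def \<psi>2_def by (rule DERIV_cong[OF DERIV_mult]) (simp add: power2_eq_square)
    qed
    show "continuous_on (ball x0 r) (\<lambda>x. P (\<sigma> x))"
      by (rule continuous_on_compose2[OF Pc \<sigma>c]) (use r(2) in auto)
    have "continuous_on (ball x0 r) (\<lambda>x. 4 * P1 (\<sigma> x) + 4 * \<sigma> x * P2 (\<sigma> x))"
      by (intro continuous_intros continuous_on_compose2[OF P1c \<sigma>c] continuous_on_compose2[OF P2(2) \<sigma>c] \<sigma>c) (use r(2) in auto)
    then show "isCont (\<lambda>x. \<Sum>i\<in>Basis. \<psi>2 i x) x0"
      unfolding L using r(1) by (simp add: continuous_on_eq_continuous_at)
  qed (use r(2) in auto)
  then show "f x0 \<le> 4 * P1 ((norm (x0 - y))\<^sup>2) + 4 * (norm (x0 - y))\<^sup>2 * P2 ((norm (x0 - y))\<^sup>2)"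
    unfolding L \<sigma>_def .
  have "(\<sigma> has_derivative (\<lambda>h. 2 * ((x0 - y) \<bullet> h))) (at x0)"
    unfolding \<sigma>_def power2_norm_eq_inner by (auto intro!: derivative_eq_intros simp: inner_commute)
  moreover have "(P has_derivative (*) (P1 (\<sigma> x0))) (at (\<sigma> x0))"
    using P1[OF S(2)] unfolding \<sigma>_def has_field_derivative_def .
  ultimately have "((\<lambda>x. P (\<sigma> x)) has_derivative (\<lambda>h. P1 (\<sigma> x0) * (2 * ((x0 - y) \<bullet> h)))) (at x0)"
    by (rule has_derivative_compose)
  then have "((\<lambda>x. u x - P (\<sigma> x)) has_derivative (\<lambda>h. h \<bullet> g - P1 (\<sigma> x0) * (2 * ((x0 - y) \<bullet> h)))) (at x0)"
    using g unfolding gderiv_def by (intro has_derivative_diff) auto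
  from differential_zero_maxmin[OF _ open_ball[of x0 r] this] r
  have "(\<lambda>h. h \<bullet> g - P1 (\<sigma> x0) * (2 * ((x0 - y) \<bullet> h))) = (\<lambda>h. 0)" by auto
  then have "h \<bullet> (g - (2 * P1 (\<sigma> x0)) *\<^sub>R (x0 - y)) = 0" for h
    by (simp add: fun_eq_iff inner_diff_right inner_diff_left inner_commute[of x0] inner_commute[of y] algebra_simps)
  from this[of "g - (2 * P1 (\<sigma> x0)) *\<^sub>R (x0 - y)"]
  show "g = (2 * P1 ((norm (x0 - y))\<^sup>2)) *\<^sub>R (x0 - y)" unfolding \<sigma>_def by simp
qed

section \<open>Radial comparison functions for the equation\<close>

text \<open>\<open>g\<close> is a separate parameter: it extends the gradient continuously to the
  unit circle, where differentiability of \<open>u\<close> is not part of the setting.\<close>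

locale punctured_solution =
  fixes m a b q :: real and u :: "real^2 \<Rightarrow> real" and g :: "real^2 \<Rightarrow> real^2"
  assumes m: "m > 0" and a: "a > 0" and b: "b > 0" and q: "q > 2"
    and cont: "continuous_on (cball 0 1 - {0}) u"
    and gcont: "continuous_on (cball 0 1 - {0}) g"
    and grad: "\<And>x. x \<in> ball 0 1 - {0} \<Longrightarrow> GDERIV u x :> g x"
    and pos: "\<And>x. x \<in> ball 0 1 - {0} \<Longrightarrow> u x > 0"
    and sol: "distributional_solution m a b q (ball 0 1 - {0}) u"
begin

abbreviation "\<Omega> \<equiv> ball (0::real^2) 1 - {0}"

text \<open>The distributional Laplacian of \<open>u\<close>, read off from the equation.\<close>

definition rhs :: "real^2 \<Rightarrow> real" where
  "rhs x = a * exp (b * u x) - m * norm (g x) powr q"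

lemma rhs_cont: "continuous_on \<Omega> rhs"
  unfolding rhs_def using q
  by (intro continuous_intros continuous_on_powr' continuous_on_subset[OF cont] continuous_on_subset[OF gcont]) auto

lemma weak:
  assumes "test_function \<Omega> \<phi>"
  shows "(LINT x:\<Omega>|lborel. u x * laplacian \<phi> x - rhs x * \<phi> x) = 0"
proof -
  have G: "Defs.grad u x = g x" if "x \<in> \<Omega>" for x
  proof -
    have "(u has_derivative (\<lambda>h. h \<bullet> g x)) (at x)" using grad[OF that] by (simp add: gderiv_def)
    then have "partial_deriv u i x = g x \<bullet> i" for i by (simp add: partial_derivI inner_commute)
    then show ?thesis unfolding Defs.grad_def by (simp add: euclidean_representation)
  qed
  have "(LINT x:\<Omega>|lborel. u x * laplacian \<phi> x - rhs x * \<phi> x)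
     = (LINT x:\<Omega>|lborel. - (- u x * laplacian \<phi> x + a * exp (b * u x) * \<phi> x - m * norm (Defs.grad u x) powr q * \<phi> x))"
    unfolding set_lebesgue_integral_def
  proof (intro Bochner_Integration.integral_cong refl)
    show "indicator \<Omega> x *\<^sub>R (u x * laplacian \<phi> x - rhs x * \<phi> x) = indicator \<Omega> x *\<^sub>R
      (- (- u x * laplacian \<phi> x + a * exp (b * u x) * \<phi> x - m * norm (Defs.grad u x) powr q * \<phi> x))" for x
      using G[of x] by (cases "x \<in> \<Omega>") (simp_all add: rhs_def algebra_simps)
  qed
  also have "\<dots> = - (LINT x:\<Omega>|lborel. - u x * laplacian \<phi> x + a * exp (b * u x) * \<phi> x - m * norm (Defs.grad u x) powr q * \<phi> x)"
    unfolding set_lebesgue_integral_def scaleR_minus_right by (rule integral_minus)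
  finally show ?thesis using sol assms unfolding distributional_solution_def by simp
qed

text \<open>At a touching point the gradient of \<open>u\<close> is that of the profile, so the
  gradient term is explicit too and the weak equation becomes a pointwise inequality for
  \<open>P\<close>.\<close>

lemma touch_above:
  fixes P P1 P2 :: "real \<Rightarrow> real"
  assumes x0: "x0 \<in> \<Omega>" and S: "open S" "(norm (x0 - y))\<^sup>2 \<in> S"
    and P1: "\<And>s. s \<in> S \<Longrightarrow> (P has_field_derivative P1 s) (at s)"
    and P2: "\<And>s. s \<in> S \<Longrightarrow> (P1 has_field_derivative P2 s) (at s)" "continuous_on S P2"
    and max: "eventually (\<lambda>x. u x - P ((norm (x - y))\<^sup>2) \<le> u x0 - P ((norm (x0 - y))\<^sup>2)) (nhds x0)"
  defines "r \<equiv> norm (x0 - y)"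
  shows "a * exp (b * u x0) \<le> 4 * P1 (r\<^sup>2) + 4 * r\<^sup>2 * P2 (r\<^sup>2) + m * (2 * r * \<bar>P1 (r\<^sup>2)\<bar>) powr q"
proof -
  note R = radial_touching_above[OF continuous_on_subset[OF cont] rhs_cont _ x0 weak grad[OF x0] S P1 P2 max]
  have "rhs x0 \<le> 4 * P1 (r\<^sup>2) + 4 * r\<^sup>2 * P2 (r\<^sup>2)" unfolding r_def by (rule R(1)) auto
  moreover have "g x0 = (2 * P1 (r\<^sup>2)) *\<^sub>R (x0 - y)" unfolding r_def by (rule R(2)) auto
  then have "norm (g x0) = 2 * r * \<bar>P1 (r\<^sup>2)\<bar>" unfolding r_def by (simp add: abs_mult)
  ultimately show ?thesis unfolding rhs_def by simp
qed

text \<open>Touching from above for \<open>- u\<close>, whose distributional Laplacian is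
  \<open>- rhs\<close>; the gradient enters only through its norm.\<close>

lemma touch_below:
  fixes P P1 P2 :: "real \<Rightarrow> real"
  assumes x0: "x0 \<in> \<Omega>" and S: "open S" "(norm (x0 - y))\<^sup>2 \<in> S"
    and P1: "\<And>s. s \<in> S \<Longrightarrow> (P has_field_derivative P1 s) (at s)"
    and P2: "\<And>s. s \<in> S \<Longrightarrow> (P1 has_field_derivative P2 s) (at s)" "continuous_on S P2"
    and min: "eventually (\<lambda>x. u x - P ((norm (x - y))\<^sup>2) \<ge> u x0 - P ((norm (x0 - y))\<^sup>2)) (nhds x0)"
  defines "r \<equiv> norm (x0 - y)"
  shows "4 * P1 (r\<^sup>2) + 4 * r\<^sup>2 * P2 (r\<^sup>2) + m * (2 * r * \<bar>P1 (r\<^sup>2)\<bar>) powr q \<le> a * exp (b * u x0)"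
proof -
  have w: "(LINT x:\<Omega>|lborel. - u x * laplacian \<phi> x - - rhs x * \<phi> x) = 0" if "test_function \<Omega> \<phi>" for \<phi>
  proof -
    have "(LINT x:\<Omega>|lborel. - u x * laplacian \<phi> x - - rhs x * \<phi> x) = (LINT x:\<Omega>|lborel. - (u x * laplacian \<phi> x - rhs x * \<phi> x))"
      by (simp add: algebra_simps)
    also have "\<dots> = - (LINT x:\<Omega>|lborel. u x * laplacian \<phi> x - rhs x * \<phi> x)"
      unfolding set_lebesgue_integral_def scaleR_minus_right by (rule integral_minus)
    finally show ?thesis using weak[OF that] by simp
  qed
  have gm: "GDERIV (\<lambda>x. - u x) x0 :> - g x0" by (rule GDERIV_minus[OF grad[OF x0]])
  have c1: "continuous_on \<Omega> (\<lambda>x. - u x)" by (intro continuous_intros continuous_on_subset[OF cont]) auto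
  have c2: "continuous_on \<Omega> (\<lambda>x. - rhs x)" by (intro continuous_intros rhs_cont)
  have o: "open \<Omega>" by auto
  have P2c: "continuous_on S (\<lambda>s. - P2 s)" by (intro continuous_intros P2)
  have max: "eventually (\<lambda>x. - u x - - P ((norm (x - y))\<^sup>2) \<le> - u x0 - - P ((norm (x0 - y))\<^sup>2)) (nhds x0)"
    using min by eventually_elim simp
  note R = radial_touching_above[OF c1 c2 o x0 w gm S DERIV_minus[OF P1] DERIV_minus[OF P2(1)] P2c max]
  have "- rhs x0 \<le> 4 * - P1 (r\<^sup>2) + 4 * r\<^sup>2 * - P2 (r\<^sup>2)" unfolding r_def by (rule R(1))
  moreover have "- g x0 = (2 * - P1 (r\<^sup>2)) *\<^sub>R (x0 - y)" unfolding r_def by (rule R(2))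
  then have "norm (- g x0) = norm ((2 * - P1 (r\<^sup>2)) *\<^sub>R (x0 - y))" by simp
  then have "norm (g x0) = 2 * r * \<bar>P1 (r\<^sup>2)\<bar>" unfolding r_def by (simp add: abs_mult)
  ultimately show ?thesis unfolding rhs_def by simp
qed


section \<open>The substitution \<open>w = e^(-u/k)\<close> and the linear lower bound for
  \<open>w\<close>\<close>

definition k :: real where "k = q / b"

definition w :: "real^2 \<Rightarrow> real" where "w x = exp (- u x / k)"

lemma k_pos: "k > 0" using q b by (simp add: k_def)

lemma w_pos: "w x > 0" by (simp add: w_def)

lemma w_less_1: "x \<in> \<Omega> \<Longrightarrow> w x < 1"
  using pos[of x] k_pos by (simp add: w_def)

lemma u_eq_ln_w: "u x = - k * ln (w x)"
  using k_pos by (simp add: w_def)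

text \<open>The reason for \<open>k = q / b\<close>: after multiplication by \<open>w powr q\<close>
  the exponential term becomes the constant \<open>a\<close>, and the gradient term loses its power
  of \<open>w\<close> as well.\<close>

lemma exp_bu: "exp (b * u x) = w x powr (- q)"
  using b q by (simp add: w_def powr_def k_def)

lemma w_cont: "continuous_on (cball 0 1 - {0}) w"
  unfolding w_def using k_pos by (intro continuous_intros cont) auto

text \<open>The comparison function is \<open>- k ln (\<rho>\<^sup>2 - |x - y|\<^sup>2)\<close> on the ball of radius \<open>\<rho> = |y|/2\<close> about \<open>y\<close>.\<close>

lemma exp_u_le:
  "\<exists>C>0. \<forall>y. 0 < norm y \<and> norm y < 1/2 \<longrightarrow> exp (u y / k) * norm y \<le> C"
proof -
  \<comment> \<open>\<open>C0\<close> collects what the touching inequality leaves at the maximum: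
    \<open>4 * k\<close> from the Laplacian and \<open>m * (2 * k) powr q\<close> from the gradient,
    each as a factor of \<open>\<rho> powr q\<close>.\<close>
  define C0 where "C0 = (4 * k + m * (2 * k) powr q) / a"
  define C1 where "C1 = C0 powr (1 / q)"
  have C0: "C0 > 0" unfolding C0_def using k_pos m a by (intro divide_pos_pos add_pos_pos) auto
  then have C1: "C1 > 0" unfolding C1_def by simp
  have "exp (u y / k) * norm y \<le> 2 * C1" if y: "0 < norm y" "norm y < 1/2" for y
  proof -
    define \<rho> where "\<rho> = norm y / 2"
    have \<rho>: "0 < \<rho>" "\<rho> \<le> 1" using y unfolding \<rho>_def by auto
    define R where "R = \<rho>\<^sup>2"
    have R: "0 < R" using \<rho> unfolding R_def by auto
    have sub: "cball y \<rho> \<subseteq> \<Omega>"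
    proof
      fix x assume "x \<in> cball y \<rho>"
      then have "norm (x - y) \<le> norm y / 2" by (simp add: dist_norm \<rho>_def norm_minus_commute)
      with norm_triangle_ineq[of "x - y" y] y show "x \<in> \<Omega>" by auto
    qed
    \<comment> \<open>The exponential of \<open>u\<close> minus the barrier, divided by
      \<open>k\<close>. In this form it is continuous on the closed ball and vanishes on its
      boundary sphere, so a maximum exists and lies inside.\<close>
    define H where "H = (\<lambda>x. exp (u x / k) * (R - (norm (x - y))\<^sup>2))"
    have "continuous_on (cball y \<rho>) u" by (rule continuous_on_subset[OF cont]) (use sub in auto)
    then have "continuous_on (cball y \<rho>) H"
      unfolding H_def using k_pos by (intro continuous_intros) auto
    moreover have "cball y \<rho> \<noteq> {}" using \<rho> by auto
    ultimately obtain x0 where x0: "x0 \<in> cball y \<rho>" "\<And>x. x \<in> cball y \<rho> \<Longrightarrow> H x \<le> H x0"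
      using continuous_attains_sup[OF compact_cball] by blast
    define r where "r = norm (x0 - y)"
    have Hy: "H y = exp (u y / k) * R" by (simp add: H_def)
    then have "H x0 > 0" using x0(2)[of y] R \<rho> by (smt (verit) centre_in_cball exp_gt_zero mult_pos_pos)
    then have D: "R - r\<^sup>2 > 0" unfolding H_def r_def by (simp add: zero_less_mult_iff)
    have r: "0 \<le> r" "r \<le> \<rho>" using x0(1) unfolding r_def by (auto simp: dist_norm norm_minus_commute)
    have max: "eventually (\<lambda>x. u x - - k * ln (R - (norm (x - y))\<^sup>2) \<le> u x0 - - k * ln (R - (norm (x0 - y))\<^sup>2)) (nhds x0)"
    proof -
      have "dist y x0 < \<rho>"
        using D r power_mono[of \<rho> r 2] unfolding R_def r_def by (auto simp: dist_norm norm_minus_commute not_le[symmetric])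
      then have "eventually (\<lambda>x. x \<in> ball y \<rho>) (nhds x0)"
        by (intro eventually_nhds_in_open) auto
      then show ?thesis
      proof eventually_elim
        case (elim x)
        then have "(norm (x - y))\<^sup>2 < R" unfolding R_def
          by (intro power_strict_mono) (auto simp: dist_norm norm_minus_commute)
        moreover have "ln (H x) \<le> ln (H x0)"
          using x0(2)[of x] elim calculation \<open>H x0 > 0\<close> by (intro ln_mono) (auto simp: H_def)
        ultimately have "u x / k + ln (R - (norm (x - y))\<^sup>2) \<le> u x0 / k + ln (R - (norm (x0 - y))\<^sup>2)"
          using D unfolding H_def r_def by (simp add: ln_mult)
        then have "k * (u x / k + ln (R - (norm (x - y))\<^sup>2)) \<le> k * (u x0 / k + ln (R - (norm (x0 - y))\<^sup>2))"
          using k_pos by (intro mult_left_mono) auto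
        then show ?case using k_pos by (simp add: distrib_left)
      qed
    qed
    have "a * exp (b * u x0) \<le> 4 * (k / (R - r\<^sup>2)) + 4 * r\<^sup>2 * (k / (R - r\<^sup>2)\<^sup>2) + m * (2 * r * \<bar>k / (R - r\<^sup>2)\<bar>) powr q"
      unfolding r_def
    proof (rule touch_above[OF _ _ _ _ _ _ max])
      show "x0 \<in> \<Omega>" using x0(1) sub by blast
      show "open {..<R}" "(norm (x0 - y))\<^sup>2 \<in> {..<R}" using D by (auto simp: r_def)
    next
      fix s assume "s \<in> {..<R}"
      then show "((\<lambda>s. - k * ln (R - s)) has_field_derivative k / (R - s)) (at s)"
        "((\<lambda>s. k / (R - s)) has_field_derivative k / (R - s)\<^sup>2) (at s)"
        by (auto intro!: derivative_eq_intros simp: power2_eq_square)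
    next
      show "continuous_on {..<R} (\<lambda>s. k / (R - s)\<^sup>2)" by (intro continuous_intros) auto
    qed
    define E where "E = R - r\<^sup>2"
    have E: "E > 0" "E \<le> R" using D unfolding E_def by auto
    \<comment> \<open>The two fractions combine because \<open>E + r\<^sup>2 = R\<close>.\<close>
    have "4 * (k / E) + 4 * r\<^sup>2 * (k / E\<^sup>2) = 4 * k * R / E\<^sup>2"
      using E(1) unfolding E_def by (simp add: divide_simps) (simp add: algebra_simps power2_eq_square)
    with \<open>a * exp (b * u x0) \<le> _\<close>[folded E_def]
    have 1: "a * exp (b * u x0) \<le> 4 * k * R / E\<^sup>2 + m * (2 * r * k / E) powr q"
      using E k_pos by simp
    have X: "exp (b * u x0) = exp (u x0 / k) powr q" using b q by (simp add: powr_def k_def)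
    have "a * (H x0) powr q = a * exp (b * u x0) * E powr q"
      unfolding H_def X r_def[symmetric] E_def[symmetric] using E by (simp add: powr_mult)
    also have "\<dots> \<le> (4 * k * R / E\<^sup>2 + m * (2 * r * k / E) powr q) * E powr q"
      using 1 by (intro mult_right_mono) auto
    also have "\<dots> = 4 * k * (R * E powr (q - 2)) + m * (2 * r * k) powr q"
      using E r k_pos by (simp add: algebra_simps powr_divide powr_diff powr_numeral)
    also have "\<dots> \<le> 4 * k * \<rho> powr q + m * (2 * \<rho> * k) powr q"
    proof (intro add_mono mult_left_mono)
      \<comment> \<open>Here \<open>q > 2\<close> enters: \<open>E \<le> R = \<rho>\<^sup>2\<close>
        bounds the positive power, and \<open>2 * q - 2 \<ge> q\<close> with
        \<open>\<rho> \<le> 1\<close> brings the Laplacian term down to the order of the gradient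
        term.\<close>
      have "R * E powr (q - 2) \<le> R * R powr (q - 2)"
        using E q R by (intro mult_left_mono powr_mono2) auto
      also have "\<dots> = \<rho> powr (2 * q - 2)"
        using \<rho> unfolding R_def by (simp add: powr_powr powr_diff powr_numeral flip: powr_numeral) (simp add: field_simps flip: powr_add)
      also have "\<dots> \<le> \<rho> powr q" using \<rho> q by (intro powr_mono') auto
      finally show "R * E powr (q - 2) \<le> \<rho> powr q" .
      show "(2 * r * k) powr q \<le> (2 * \<rho> * k) powr q" using r k_pos q by (intro powr_mono2) auto
    qed (use k_pos m in auto)
    also have "\<dots> = a * (C0 * \<rho> powr q)"
      unfolding C0_def using a \<rho> k_pos by (simp add: powr_mult field_simps)
    finally have "H x0 powr q \<le> C0 * \<rho> powr q" using a by simp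
    also have "\<dots> = (C1 * \<rho>) powr q"
      unfolding C1_def using C0 \<rho> q by (simp add: powr_mult powr_powr)
    finally have "H x0 \<le> C1 * \<rho>"
      using \<open>H x0 > 0\<close> C1 \<rho> q by (smt (verit) powr_less_mono2 mult_pos_pos)
    moreover have "exp (u y / k) * R \<le> H x0" using x0(2)[of y] Hy \<rho> by auto
    ultimately have "exp (u y / k) * \<rho> * \<rho> \<le> C1 * \<rho>" by (simp add: R_def power2_eq_square)
    then have "exp (u y / k) * \<rho> \<le> C1" using \<rho> by simp
    then show ?thesis unfolding \<rho>_def by simp
  qed
  then show ?thesis using C1 by (intro exI[of _ "2 * C1"]) auto
qed

text \<open>As a function of the squared distance, \<open>- k ln p\<close> touches \<open>u\<close>
  from below. The logarithm contributes the nonnegative term \<open>k (p1/p)^2\<close> to its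
  Laplacian, which is discarded; multiplication by \<open>w^q\<close> does the rest. Since
  \<open>T\<close> excludes 0, the profile may be singular at \<open>y\<close>.\<close>

lemma w_touch_above_polar:
  assumes x0: "x0 \<in> \<Omega>" and T: "open T" "T \<subseteq> {0<..}" "norm (x0 - y) \<in> T"
    and p1: "\<And>r. r \<in> T \<Longrightarrow> (p has_field_derivative p1 r) (at r)"
    and p2: "\<And>r. r \<in> T \<Longrightarrow> (p1 has_field_derivative p2 r) (at r)" "continuous_on T p2"
    and eq: "w x0 = p (norm (x0 - y))" and le: "eventually (\<lambda>x. w x \<le> p (norm (x - y))) (nhds x0)"
  defines "r \<equiv> norm (x0 - y)"
  shows "m * (k * \<bar>p1 r\<bar>) powr q \<le> a + k * w x0 powr (q - 1) * (p2 r + p1 r / r)"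
proof -
  define S where "S = {s \<in> {0<..}. sqrt s \<in> {\<rho> \<in> T. p \<rho> \<in> {0<..}}}"
  have pc: "continuous_on T p" and p1c: "continuous_on T p1"
    using p1 p2(1) DERIV_isCont continuous_at_imp_continuous_on by blast+
  have "open {\<rho> \<in> T. p \<rho> \<in> {0<..}}"
    using continuous_open_preimage[OF pc T(1) open_greaterThan[of 0]] by (simp add: vimage_def Int_def)
  then have S: "open S"
    unfolding S_def using continuous_open_preimage[of "{0<..}" sqrt "{\<rho> \<in> T. p \<rho> \<in> {0<..}}"]
    by (simp add: continuous_on_real_sqrt vimage_def Int_def)
  have r: "r > 0" "r \<in> T" using T unfolding r_def by auto
  have pr: "p r = w x0" using eq unfolding r_def by simp
  have inS: "r\<^sup>2 \<in> S" using r w_pos[of x0] pr unfolding S_def by simp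
  define P where "P = (\<lambda>s. - k * ln (p (sqrt s)))"
  define P1 where "P1 = (\<lambda>s. - k * p1 (sqrt s) / (2 * sqrt s * p (sqrt s)))"
  define P2 where "P2 = (\<lambda>s. - k * (p2 (sqrt s) * sqrt s * p (sqrt s) - p1 (sqrt s) * p (sqrt s) - sqrt s * (p1 (sqrt s))\<^sup>2)
      / (4 * sqrt s ^ 3 * (p (sqrt s))\<^sup>2))"
  have dP: "(P has_field_derivative P1 s) (at s)" "(P1 has_field_derivative P2 s) (at s)" if "s \<in> S" for s
  proof -
    have s: "s > 0" "sqrt s \<in> T" "p (sqrt s) > 0" "sqrt s > 0" using that unfolding S_def by auto
    have sq: "(sqrt has_field_derivative inverse (sqrt s) / 2) (at s)" using DERIV_real_sqrt[OF s(1)] .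
    have a1: "((\<lambda>s. p (sqrt s)) has_field_derivative p1 (sqrt s) * (inverse (sqrt s) / 2)) (at s)"
      by (rule DERIV_chain2[OF p1[OF s(2)] sq])
    have a2: "((\<lambda>s. p1 (sqrt s)) has_field_derivative p2 (sqrt s) * (inverse (sqrt s) / 2)) (at s)"
      by (rule DERIV_chain2[OF p2(1)[OF s(2)] sq])
    show "(P has_field_derivative P1 s) (at s)"
      unfolding P_def P1_def
      by (rule DERIV_cong[OF DERIV_cmult[OF DERIV_chain2[OF DERIV_ln_divide[OF s(3)] a1]]])
        (use s in \<open>simp add: field_simps\<close>)
    define t where "t = sqrt s"
    have "((\<lambda>s. - k * p1 (sqrt s) / (2 * sqrt s * p (sqrt s))) has_field_derivative
       ((- k * (p2 t * (inverse t / 2))) * (2 * t * p t) - (- k * p1 t) * (2 * (inverse t / 2) * p t + p1 t * (inverse t / 2) * (2 * t)))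
        / ((2 * t * p t) * (2 * t * p t))) (at s)"
      unfolding t_def
      by (rule DERIV_divide DERIV_cmult DERIV_mult sq a1 a2)+ (use s in auto)
    moreover have "((- k * (p2 t * (inverse t / 2))) * (2 * t * p t) - (- k * p1 t) * (2 * (inverse t / 2) * p t + p1 t * (inverse t / 2) * (2 * t)))
        / ((2 * t * p t) * (2 * t * p t)) = P2 s"
      using s unfolding P2_def t_def[symmetric]
      by (simp add: divide_simps) (simp add: algebra_simps power2_eq_square power3_eq_cube)
    ultimately show "(P1 has_field_derivative P2 s) (at s)" unfolding P1_def by simp
  qed
  have cS: "continuous_on S (\<lambda>s. p (sqrt s))" "continuous_on S (\<lambda>s. p1 (sqrt s))" "continuous_on S (\<lambda>s. p2 (sqrt s))"
    by (rule continuous_on_compose2[OF pc] continuous_on_compose2[OF p1c] continuous_on_compose2[OF p2(2)];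
        auto simp: S_def intro: continuous_intros)+
  have P2c: "continuous_on S P2"
    unfolding P2_def by (intro continuous_intros cS) (auto simp: S_def)
  have "4 * P1 (r\<^sup>2) + 4 * r\<^sup>2 * P2 (r\<^sup>2) + m * (2 * r * \<bar>P1 (r\<^sup>2)\<bar>) powr q \<le> a * exp (b * u x0)"
    unfolding r_def
  proof (rule touch_below[OF x0 S _ dP P2c])
    show "(norm (x0 - y))\<^sup>2 \<in> S" using inS r_def by simp
    show "eventually (\<lambda>x. u x - P ((norm (x - y))\<^sup>2) \<ge> u x0 - P ((norm (x0 - y))\<^sup>2)) (nhds x0)"
      using le
    proof eventually_elim
      case (elim x)
      have "ln (w x) \<le> ln (p (norm (x - y)))" using elim w_pos[of x] by (intro ln_mono) auto
      then have "k * ln (w x) \<le> k * ln (p (norm (x - y)))" using k_pos by (intro mult_left_mono) auto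
      then show ?case unfolding P_def using eq by (simp add: u_eq_ln_w)
    qed
  qed
  then have main: "4 * P1 (r\<^sup>2) + 4 * r\<^sup>2 * P2 (r\<^sup>2) + m * (2 * r * \<bar>P1 (r\<^sup>2)\<bar>) powr q \<le> a * w x0 powr (- q)"
    by (simp add: exp_bu)
  define W where "W = w x0"
  have W: "W > 0" "p r = W" using w_pos pr unfolding W_def by auto
  have "4 * P1 (r\<^sup>2) + 4 * r\<^sup>2 * P2 (r\<^sup>2) = - k * ((p2 r + p1 r / r) / W - (p1 r)\<^sup>2 / W\<^sup>2)"
    using r W unfolding P1_def P2_def
    by (simp add: divide_simps) (simp add: algebra_simps power2_eq_square power3_eq_cube)
  also have "\<dots> \<ge> - k * ((p2 r + p1 r / r) / W)"
    using k_pos by (simp add: algebra_simps)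
  finally have l: "- k * ((p2 r + p1 r / r) / W) \<le> 4 * P1 (r\<^sup>2) + 4 * r\<^sup>2 * P2 (r\<^sup>2)" .
  have "2 * r * \<bar>P1 (r\<^sup>2)\<bar> = k * \<bar>p1 r\<bar> / W"
    using r W k_pos unfolding P1_def by (simp add: abs_mult abs_divide)
  with main l have "- k * ((p2 r + p1 r / r) / W) + m * (k * \<bar>p1 r\<bar> / W) powr q \<le> a * W powr (- q)"
    unfolding W_def by simp
  then have "W powr q * (- k * ((p2 r + p1 r / r) / W) + m * (k * \<bar>p1 r\<bar> / W) powr q) \<le> W powr q * (a * W powr (- q))"
    by (intro mult_left_mono) auto
  moreover have "W powr q * (a * W powr (- q)) = a" using W by (simp add: powr_minus)
  moreover have "W powr q * (- k * ((p2 r + p1 r / r) / W) + m * (k * \<bar>p1 r\<bar> / W) powr q) =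
      - k * (W powr q * ((p2 r + p1 r / r) / W)) + m * (W powr q * (k * \<bar>p1 r\<bar> / W) powr q)"
    by (simp only: distrib_left mult.left_commute)
  moreover have "W powr q * (k * \<bar>p1 r\<bar> / W) powr q = (k * \<bar>p1 r\<bar>) powr q"
    using W k_pos by (simp add: powr_divide)
  moreover have "W powr q * ((p2 r + p1 r / r) / W) = W powr (q - 1) * (p2 r + p1 r / r)"
    using W by (simp add: powr_diff)
  ultimately have "- k * (W powr (q - 1) * (p2 r + p1 r / r)) + m * (k * \<bar>p1 r\<bar>) powr q \<le> a"
    by (simp only:)
  then show ?thesis unfolding W_def[symmetric] by (simp add: mult.assoc)
qed


section \<open>Hoelder continuity of the transformed solution\<close>

text \<open>The exponent for which \<open>(r\<^sup>\<alpha>\<^sup>-\<^sup>1)\<^sup>q\<close> and \<open>r\<^sup>\<alpha>\<^sup>-\<^sup>2\<close>, the sizes of gradient term and Laplacian of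
  \<open>r\<^sup>\<alpha>\<close>, are the same power of \<open>r\<close>.\<close>

definition \<alpha> :: real where "\<alpha> = (q - 2) / (q - 1)"

lemma \<alpha>: "0 < \<alpha>" "\<alpha> < 1" "(\<alpha> - 1) * q = \<alpha> - 2"
  using q unfolding \<alpha>_def by (auto simp: divide_simps algebra_simps)

text \<open>Let \<open>\<mu>\<close> be the distance of \<open>r\<close> from the singular points 0
  and \<open>\<rho>\<close> of the slope of \<open>\<Phi>\<close>. At a touching point the gradient
  term is at least \<open>m (k K \<alpha>)^q \<mu>^(\<alpha>-2)\<close>, while \<open>a\<close> and
  the Laplacian term give at most \<open>(a + 3 k K \<alpha>) \<mu>^(\<alpha>-2)\<close>. The choice
  of \<open>K\<close> forbids this.\<close>

lemma no_interior_touching: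
  assumes x0: "x0 \<in> \<Omega>" and \<rho>: "\<rho> \<le> 1" and r: "0 < norm (x0 - y)" "norm (x0 - y) < \<rho>"
    and K: "K > 0" "m * (k * (K * \<alpha>)) powr q > a + 3 * k * (K * \<alpha>)"
  defines "\<Phi> \<equiv> \<lambda>r. K * (r powr \<alpha> + \<rho> powr \<alpha> - (\<rho> - r) powr \<alpha>)"
  shows "\<not> eventually (\<lambda>x. w x - \<Phi> (norm (x - y)) \<le> w x0 - \<Phi> (norm (x0 - y))) (nhds x0)"
proof
  assume max: "eventually (\<lambda>x. w x - \<Phi> (norm (x - y)) \<le> w x0 - \<Phi> (norm (x0 - y))) (nhds x0)"
  define r where "r = norm (x0 - y)"
  define c where "c = w x0 - \<Phi> r"
  define p1 where "p1 = (\<lambda>r. K * \<alpha> * (r powr (\<alpha> - 1) + (\<rho> - r) powr (\<alpha> - 1)))"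
  define p2 where "p2 = (\<lambda>r. K * \<alpha> * (\<alpha> - 1) * (r powr (\<alpha> - 2) - (\<rho> - r) powr (\<alpha> - 2)))"
  have r: "0 < r" "r < \<rho>" using r unfolding r_def by auto
  define A where "A = m * (k * (K * \<alpha>)) powr q"
  define \<mu> where "\<mu> = min r (\<rho> - r)"
  have \<mu>: "0 < \<mu>" "\<mu> \<le> 1" "\<mu> \<le> r" "\<mu> \<le> \<rho> - r" using r \<rho> unfolding \<mu>_def by auto
  have "m * (k * \<bar>p1 r\<bar>) powr q \<le> a + k * w x0 powr (q - 1) * (p2 r + p1 r / r)"
    unfolding r_def
  proof (rule w_touch_above_polar[OF x0, where T = "{0<..<\<rho>}" and p = "\<lambda>r. c + \<Phi> r"])
    show "norm (x0 - y) \<in> {0<..<\<rho>}" using r unfolding r_def by auto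
    fix t assume t: "t \<in> {0<..<\<rho>}"
    then show "((\<lambda>r. c + \<Phi> r) has_field_derivative p1 t) (at t)"
      unfolding \<Phi>_def p1_def by (auto intro!: derivative_eq_intros simp: algebra_simps)
    show "(p1 has_field_derivative p2 t) (at t)"
      unfolding p1_def p2_def using t by (auto intro!: derivative_eq_intros simp: algebra_simps)
  next
    show "continuous_on {0<..<\<rho>} p2" unfolding p2_def by (intro continuous_intros) auto
    show "w x0 = c + \<Phi> (norm (x0 - y))" unfolding c_def r_def by simp
    show "eventually (\<lambda>x. w x \<le> c + \<Phi> (norm (x - y))) (nhds x0)"
      using max unfolding c_def r_def by eventually_elim simp
  qed auto
  also have "\<dots> \<le> a + k * (3 * (K * \<alpha>) * \<mu> powr (\<alpha> - 2))"
  proof -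
    have "p1 r / r = K * \<alpha> * (r powr (\<alpha> - 2) + (\<rho> - r) powr (\<alpha> - 1) / r)"
      using r unfolding p1_def by (simp add: field_simps powr_diff powr_numeral power2_eq_square)
    then have "p2 r + p1 r / r = K * \<alpha> * (\<alpha> * r powr (\<alpha> - 2) + (1 - \<alpha>) * (\<rho> - r) powr (\<alpha> - 2) + (\<rho> - r) powr (\<alpha> - 1) / r)"
      unfolding p2_def by (simp add: algebra_simps)
    also have "\<dots> \<le> K * \<alpha> * (1 * \<mu> powr (\<alpha> - 2) + 1 * \<mu> powr (\<alpha> - 2) + \<mu> powr (\<alpha> - 1) / \<mu>)"
      using r \<mu> \<alpha> K by (intro mult_left_mono add_mono mult_mono powr_mono2' frac_le) auto
    also have "\<mu> powr (\<alpha> - 1) / \<mu> = \<mu> powr (\<alpha> - 2)"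
      using \<mu> by (simp add: powr_diff powr_numeral power2_eq_square)
    finally have lap: "p2 r + p1 r / r \<le> 3 * (K * \<alpha>) * \<mu> powr (\<alpha> - 2)" by simp
    have "w x0 powr (q - 1) \<le> 1"
      using w_pos[of x0] w_less_1[OF x0] q by (intro powr_le1) auto
    then have "w x0 powr (q - 1) * (p2 r + p1 r / r) \<le> 1 * (3 * (K * \<alpha>) * \<mu> powr (\<alpha> - 2))"
      using lap K \<alpha> by (meson mult_left_mono mult_right_mono order_trans powr_ge_zero mult_nonneg_nonneg less_imp_le zero_le_numeral)
    then show ?thesis using k_pos by (simp add: mult.assoc)
  qed
  finally have 1: "m * (k * \<bar>p1 r\<bar>) powr q \<le> a + 3 * k * (K * \<alpha>) * \<mu> powr (\<alpha> - 2)" by simp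
  have "K * \<alpha> * \<mu> powr (\<alpha> - 1) \<le> p1 r"
  proof (cases "\<mu> = r")
    case True
    then show ?thesis unfolding p1_def using K \<alpha> by (intro mult_left_mono) auto
  next
    case False
    then have "\<mu> = \<rho> - r" unfolding \<mu>_def by auto
    then show ?thesis unfolding p1_def using K \<alpha> by (intro mult_left_mono) auto
  qed
  then have "(k * (K * \<alpha> * \<mu> powr (\<alpha> - 1))) powr q \<le> (k * \<bar>p1 r\<bar>) powr q"
    using k_pos K \<alpha> q by (intro powr_mono2 mult_left_mono) auto
  moreover have "(k * (K * \<alpha> * \<mu> powr (\<alpha> - 1))) powr q = (k * (K * \<alpha>)) powr q * \<mu> powr (\<alpha> - 2)"
    using k_pos K \<alpha> by (simp add: powr_mult powr_powr flip: mult.assoc)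
  ultimately have "A * \<mu> powr (\<alpha> - 2) \<le> m * (k * \<bar>p1 r\<bar>) powr q"
    using m unfolding A_def by simp
  also note 1
  also have "a \<le> a * \<mu> powr (\<alpha> - 2)"
    using a \<mu> \<alpha> powr_mono2'[of "\<alpha> - 2" \<mu> 1] by simp
  finally have "A * \<mu> powr (\<alpha> - 2) \<le> (a + 3 * k * (K * \<alpha>)) * \<mu> powr (\<alpha> - 2)" by (simp add: algebra_simps)
  then have "A \<le> a + 3 * k * (K * \<alpha>)" using \<mu> by simp
  then show False using K unfolding A_def by simp
qed

text \<open>The slope of \<open>\<Phi>\<close> is infinite at \<open>r = \<rho>\<close>, whereas \<open>w\<close> is differentiable there. This keeps \<open>K\<close>
  independent of \<open>y\<close> and \<open>\<rho>\<close>.\<close>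

lemma no_boundary_touching:
  assumes sub: "cball y \<rho> \<subseteq> \<Omega>" and K: "K > 0" and r: "norm (x0 - y) = \<rho>" "\<rho> > 0"
  defines "\<Phi> \<equiv> \<lambda>r. K * (r powr \<alpha> + \<rho> powr \<alpha> - (\<rho> - r) powr \<alpha>)"
  shows "\<exists>x\<in>cball y \<rho>. w x - \<Phi> (norm (x - y)) > w x0 - \<Phi> (norm (x0 - y))"
proof (rule ccontr)
  assume neg: "\<not> (\<exists>x\<in>cball y \<rho>. w x - \<Phi> (norm (x - y)) > w x0 - \<Phi> (norm (x0 - y)))"
  \<comment> \<open>\<open>h\<close> follows \<open>w\<close> from \<open>x0\<close> towards the
    centre. If \<open>x0\<close> were a maximum, \<open>h 0 - h t\<close> would be at least
    \<open>K (t \<rho>)^\<alpha>\<close>. Multiplied by \<open>t^(1-\<alpha>)\<close>, the negated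
    difference quotient would then stay above \<open>K \<rho>^\<alpha>\<close>, although it tends to
    0.\<close>
  define h where "h = (\<lambda>t. w (x0 + t *\<^sub>R (y - x0)))"
  have "x0 \<in> cball y \<rho>" using r by (simp add: dist_norm norm_minus_commute)
  then have x0: "x0 \<in> \<Omega>" using sub by blast
  have du: "(u has_derivative (\<lambda>v. v \<bullet> g x0)) (at (x0 + 0 *\<^sub>R (y - x0)))" using grad[OF x0] by (simp add: gderiv_def)
  have "((\<lambda>t. u (x0 + t *\<^sub>R (y - x0))) has_derivative (\<lambda>t. (t *\<^sub>R (y - x0)) \<bullet> g x0)) (at 0)"
    by (rule has_derivative_compose[where g = u and f = "\<lambda>t. x0 + t *\<^sub>R (y - x0)", OF _ du]) (auto intro!: derivative_eq_intros)
  then have dl: "((\<lambda>t. u (x0 + t *\<^sub>R (y - x0))) has_field_derivative (y - x0) \<bullet> g x0) (at 0)"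
    by (rule has_derivative_imp_has_field_derivative) (simp add: mult.commute)
  then obtain D where "(h has_field_derivative D) (at 0)"
    unfolding h_def w_def using DERIV_chain2[OF DERIV_exp DERIV_cdivide[OF DERIV_minus[OF dl]]] by blast
  then have lim: "((\<lambda>t. (h t - h 0) / t) \<longlongrightarrow> D) (at_right 0)"
    unfolding DERIV_def by (auto intro: tendsto_within_subset)
  have "((\<lambda>t. t powr (1 - \<alpha>)) \<longlongrightarrow> 0 powr (1 - \<alpha>)) (at_right (0::real))"
    using \<alpha> by (intro tendsto_powr') (auto simp: eventually_at_right_field intro!: exI[of _ 1] tendsto_ident_at)
  from tendsto_mult[OF this tendsto_minus[OF lim]]
  have "((\<lambda>t. t powr (1 - \<alpha>) * - ((h t - h 0) / t)) \<longlongrightarrow> 0) (at_right 0)" by simp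
  moreover have "eventually (\<lambda>t. K * \<rho> powr \<alpha> \<le> t powr (1 - \<alpha>) * - ((h t - h 0) / t)) (at_right 0)"
    unfolding eventually_at_right_field
  proof (intro exI[of _ 1] conjI allI impI)
    fix t :: real assume t: "0 < t" "t < 1"
    let ?x = "x0 + t *\<^sub>R (y - x0)"
    have "?x - y = (1 - t) *\<^sub>R (x0 - y)" by (simp add: algebra_simps)
    then have n: "norm (?x - y) = (1 - t) * \<rho>" using r t by simp
    then have "?x \<in> cball y \<rho>" using t r by (simp add: dist_norm norm_minus_commute[of y] mult_left_le_one_le)
    with neg have "w ?x - \<Phi> ((1 - t) * \<rho>) \<le> w x0 - \<Phi> \<rho>" using n r by force
    moreover have "\<Phi> \<rho> - \<Phi> ((1 - t) * \<rho>) = K * (\<rho> powr \<alpha> - ((1 - t) * \<rho>) powr \<alpha> + (t * \<rho>) powr \<alpha>)"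
      unfolding \<Phi>_def using \<alpha> by (simp add: algebra_simps)
    moreover have "K * (\<rho> powr \<alpha> - ((1 - t) * \<rho>) powr \<alpha> + (t * \<rho>) powr \<alpha>) \<ge> K * (t * \<rho>) powr \<alpha>"
    proof -
      have "((1 - t) * \<rho>) powr \<alpha> \<le> \<rho> powr \<alpha>"
        using t r \<alpha> by (intro powr_mono2) (auto simp: mult_left_le_one_le)
      then show ?thesis using K by (intro mult_left_mono) auto
    qed
    ultimately have "K * (t * \<rho>) powr \<alpha> \<le> h 0 - h t" unfolding h_def by simp
    then have "t powr (- \<alpha>) * (K * (t * \<rho>) powr \<alpha>) \<le> t powr (- \<alpha>) * (h 0 - h t)"
      by (intro mult_left_mono) auto
    moreover have "t powr (- \<alpha>) * (K * (t * \<rho>) powr \<alpha>) = K * \<rho> powr \<alpha>"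
      using t r by (simp add: powr_mult powr_minus)
    moreover have "t powr (- \<alpha>) * (h 0 - h t) = t powr (1 - \<alpha>) * - ((h t - h 0) / t)"
      using t by (simp add: powr_diff powr_minus field_simps)
    ultimately show "K * \<rho> powr \<alpha> \<le> t powr (1 - \<alpha>) * - ((h t - h 0) / t)" by simp
  qed simp
  ultimately have "K * \<rho> powr \<alpha> \<le> 0"
    by (intro tendsto_lowerbound) auto
  then show False using K r by (simp add: mult_le_0_iff)
qed

text \<open>On the closed ball of radius \<open>\<rho> = |x - y|\<close> about \<open>y\<close> a
  maximum of \<open>w - \<Phi>\<close> lies neither on the sphere nor in the punctured interior,
  hence at \<open>y\<close>. Comparison with the value at \<open>x\<close> gives the bound, with
  \<open>\<Phi> \<rho> = 2 K \<rho>^\<alpha>\<close>. The conditions on \<open>x\<close> and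
  \<open>y\<close> keep the ball inside \<open>\<Omega>\<close>.\<close>

lemma w_local_bound:
  "\<exists>K>0. \<forall>x y. norm y < 1/2 \<and> norm (x - y) < norm y \<longrightarrow> w x \<le> w y + K * norm (x - y) powr \<alpha>"
proof -
  \<comment> \<open>\<open>Z\<close> will be \<open>K * \<alpha>\<close>. It is chosen so that
    \<open>m k^q Z > a + 3 k\<close>; together with \<open>Z > 1\<close> and
    \<open>Z * Z \<le> Z powr q\<close> this yields the condition that excludes interior
    touching.\<close>
  define Z where "Z = 1 + (a + 3 * k) / (m * k powr q)"
  have mk: "m * k powr q > 0" using m k_pos by simp
  have Z: "Z > 1" unfolding Z_def using mk a k_pos by simp
  define K where "K = Z / \<alpha>"
  have K: "K > 0" "K * \<alpha> = Z" unfolding K_def using Z \<alpha> by auto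
  have "a + 3 * k * Z \<le> (a + 3 * k) * Z" using Z a by (simp add: algebra_simps)
  also have "a + 3 * k < m * k powr q * Z"
  proof -
    have "c * (1 + X / c) = c + X" if "c > 0" for c X :: real
      using that by (simp add: field_simps)
    from this[OF mk] have "m * k powr q * Z = m * k powr q + (a + 3 * k)"
      unfolding Z_def .
    then show ?thesis using mk by simp
  qed
  then have "(a + 3 * k) * Z < m * k powr q * Z * Z" using Z by (intro mult_strict_right_mono) auto
  also have "m * k powr q * Z * Z \<le> m * k powr q * Z powr q"
  proof -
    have "Z * Z \<le> Z powr q" using powr_mono[of 2 q Z] Z q by (simp add: powr_numeral power2_eq_square)
    then show ?thesis unfolding mult.assoc[of _ Z Z] using mk by (intro mult_left_mono) auto
  qed
  also have "\<dots> = m * (k * Z) powr q" using k_pos Z by (simp add: powr_mult)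
  finally have KK: "m * (k * (K * \<alpha>)) powr q > a + 3 * k * (K * \<alpha>)" using K by simp
  have "w x \<le> w y + 2 * K * norm (x - y) powr \<alpha>" if xy: "norm y < 1/2" "norm (x - y) < norm y" for x y
  proof (cases "x = y")
    case False
    define \<rho> where "\<rho> = norm (x - y)"
    have \<rho>: "0 < \<rho>" "\<rho> < norm y" "\<rho> \<le> 1" using xy False unfolding \<rho>_def by auto
    have sub: "cball y \<rho> \<subseteq> \<Omega>"
    proof
      fix z assume "z \<in> cball y \<rho>"
      then have "norm (z - y) \<le> \<rho>" by (simp add: dist_norm norm_minus_commute)
      with norm_triangle_ineq[of "z - y" y] xy \<rho> show "z \<in> \<Omega>" by auto
    qed
    define \<Phi> where "\<Phi> = (\<lambda>r. K * (r powr \<alpha> + \<rho> powr \<alpha> - (\<rho> - r) powr \<alpha>))"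
    have "continuous_on (cball y \<rho>) w" by (rule continuous_on_subset[OF w_cont]) (use sub in auto)
    moreover have "continuous_on (cball y \<rho>) (\<lambda>x. \<Phi> (norm (x - y)))"
      unfolding \<Phi>_def using \<alpha>
      by (intro continuous_intros continuous_on_powr') (auto simp: dist_norm norm_minus_commute)
    ultimately have "continuous_on (cball y \<rho>) (\<lambda>x. w x - \<Phi> (norm (x - y)))"
      by (rule continuous_on_diff)
    moreover have "cball y \<rho> \<noteq> {}" using \<rho> by auto
    ultimately obtain x0 where x0: "x0 \<in> cball y \<rho>"
      "\<And>x. x \<in> cball y \<rho> \<Longrightarrow> w x - \<Phi> (norm (x - y)) \<le> w x0 - \<Phi> (norm (x0 - y))"
      using continuous_attains_sup[OF compact_cball] by blast
    have "norm (x0 - y) \<noteq> \<rho>"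
      using no_boundary_touching[OF sub K(1) _ \<rho>(1), of x0] x0(2) unfolding \<Phi>_def by (meson not_le)
    moreover have "x0 = y" if "norm (x0 - y) < \<rho>"
    proof (rule ccontr)
      assume "x0 \<noteq> y"
      have "eventually (\<lambda>x. x \<in> ball y \<rho>) (nhds x0)"
        using that by (intro eventually_nhds_in_open) (auto simp: dist_norm norm_minus_commute)
      then have "eventually (\<lambda>x. w x - \<Phi> (norm (x - y)) \<le> w x0 - \<Phi> (norm (x0 - y))) (nhds x0)"
        by eventually_elim (use x0(2) in auto)
      moreover have "x0 \<in> \<Omega>" using x0(1) sub by blast
      ultimately show False
        using no_interior_touching[OF _ \<rho>(3) _ that K(1) KK] \<open>x0 \<noteq> y\<close> unfolding \<Phi>_def by auto
    qed
    ultimately have "x0 = y" using x0(1) by (auto simp: dist_norm norm_minus_commute)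
    with x0(2)[of x] have "w x - \<Phi> \<rho> \<le> w y - \<Phi> 0"
      unfolding \<rho>_def by (simp add: dist_norm norm_minus_commute)
    moreover have "\<Phi> 0 = 0" "\<Phi> \<rho> = 2 * K * \<rho> powr \<alpha>" unfolding \<Phi>_def using \<alpha> by auto
    ultimately show ?thesis unfolding \<rho>_def by simp
  qed simp
  then show ?thesis using K by (intro exI[of _ "2 * K"]) auto
qed

end

section \<open>From local to global Hoelder bounds\<close>

text \<open>A quarter turn of \<open>x\<close>, with the sign chosen to suit \<open>y\<close>. It
  splits a pair on a circle into two pairs at angles of at most a right angle.\<close>

lemma exists_orthogonal_same_norm:
  fixes x :: "real^2"
  obtains z where "norm z = norm x" "x \<bullet> z = 0" "y \<bullet> z \<ge> 0"
proof -
  define J :: "real^2" where "J = vector [- (x $ 2), x $ 1]"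
  have J: "norm J = norm x" "x \<bullet> J = 0"
    unfolding J_def by (simp_all add: norm_vec_def L2_set_def inner_vec_def sum_2)
  show ?thesis
  proof (cases "y \<bullet> J \<ge> 0")
    case True
    with J show ?thesis by (intro that[of J])
  next
    case False
    with J show ?thesis by (intro that[of "- J"]) auto
  qed
qed

text \<open>The local bound serves pairs that are closer to each other than to the origin. Chains of
  such pairs join points of one circle in boundedly many hops and points of one ray in geometrically
  shrinking hops. So \<open>w\<close> oscillates by \<open>O(|x|^\<alpha>)\<close> on the punctured
  disk of radius \<open>|x|\<close>, which gives a limit \<open>w0\<close> at the origin and then
  the estimate for all pairs.\<close>

lemma hoelder_punctured_from_local:
  fixes w :: "real^2 \<Rightarrow> real"
  assumes K: "K > 0" and \<alpha>: "\<alpha> > 0" and \<rho>: "\<rho> > 0"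
    and loc: "\<And>x y. norm y < \<rho> \<Longrightarrow> norm (x - y) < norm y \<Longrightarrow> w x \<le> w y + K * norm (x - y) powr \<alpha>"
  shows "\<exists>C w0. \<forall>x\<in>ball 0 (\<rho> / 2). \<forall>y\<in>ball 0 (\<rho> / 2).
           \<bar>(w(0 := w0)) x - (w(0 := w0)) y\<bar> \<le> C * norm (x - y) powr \<alpha>"
proof -
  have sym: "\<bar>w x - w y\<bar> \<le> K * norm (x - y) powr \<alpha>"
    if "norm x < \<rho>" "norm y < \<rho>" "norm (x - y) < norm x" "norm (x - y) < norm y" for x y
    using loc[of y x] loc[of x y] that by (auto simp: norm_minus_commute)
  have hop: "\<bar>w x - w y\<bar> \<le> 2 * K * norm x powr \<alpha>"
    if xy: "norm x = norm y" "x \<bullet> y \<ge> 0" "norm x < \<rho> / 2" "x \<noteq> 0" for x y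
  proof -
    \<comment> \<open>A stepping stone on the bisector of \<open>x\<close> and \<open>y\<close>. As
      their angle is at most a right angle, the factor \<open>3 / 4\<close> makes its distance to
      both smaller than \<open>norm x\<close> and than \<open>norm z\<close>, as \<open>sym\<close>
      requires.\<close>
    define z where "z = (3 / 4) *\<^sub>R (x + y)"
    have n: "(norm x)\<^sup>2 = (norm y)\<^sup>2" "(norm x)\<^sup>2 > 0" using xy by auto
    have z2: "(norm z)\<^sup>2 = 9 / 8 * ((norm x)\<^sup>2 + x \<bullet> y)"
      unfolding z_def using n(1)
      by (simp add: power2_norm_eq_inner inner_add_left inner_add_right inner_commute algebra_simps)
    have zx: "(norm (x - z))\<^sup>2 = (norm x)\<^sup>2 - 3 / 8 * ((norm x)\<^sup>2 + x \<bullet> y)"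
      "(norm (y - z))\<^sup>2 = (norm x)\<^sup>2 - 3 / 8 * ((norm x)\<^sup>2 + x \<bullet> y)"
      unfolding z_def using n(1)
      by (simp_all add: power2_norm_eq_inner inner_add_left inner_add_right inner_diff_left inner_diff_right inner_commute add_divide_distrib algebra_simps)
    have less: "norm p < norm q'" if "(norm p)\<^sup>2 < (norm q')\<^sup>2" for p q' :: "real^2"
      using that by (rule power_less_imp_less_base) simp
    have cs: "x \<bullet> y \<le> (norm x)\<^sup>2" using norm_cauchy_schwarz[of x y] xy by (simp add: power2_eq_square)
    have "(norm z)\<^sup>2 \<le> (2 * norm x)\<^sup>2" 
    proof -
      have "9 / 8 * (N + c) \<le> 4 * N" if "c \<le> N" "N > 0" for c N :: real
        using that by (simp add: field_simps)
      from this[OF cs n(2)] have "(norm z)\<^sup>2 \<le> 4 * (norm x)\<^sup>2" unfolding z2 .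
      then show ?thesis by (simp add: power_mult_distrib)
    qed
    then have "norm z \<le> 2 * norm x" by (rule power2_le_imp_le) simp
    then have zr: "norm z < \<rho>" using xy by simp
    have ar: "N - 3 / 8 * (N + c) < N" "N - 3 / 8 * (N + c) < 9 / 8 * (N + c)"
      if "0 \<le> c" "N > 0" for c N :: real
      using that by (simp_all add: field_simps add_nonneg_pos add_pos_nonneg)
    have close: "\<bar>w v - w z\<bar> \<le> K * norm x powr \<alpha>" if "v = x \<or> v = y" for v
    proof -
      have v: "norm v = norm x" "(norm (v - z))\<^sup>2 = (norm x)\<^sup>2 - 3 / 8 * ((norm x)\<^sup>2 + x \<bullet> y)"
        using that xy zx by auto
      have 1: "norm (v - z) < norm v" unfolding v(1) by (rule less) (unfold v(2), rule ar(1)[OF xy(2) n(2)])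
      have 2: "norm (v - z) < norm z" by (rule less) (unfold v(2) z2, rule ar(2)[OF xy(2) n(2)])
      have "\<bar>w v - w z\<bar> \<le> K * norm (v - z) powr \<alpha>"
        using 1 2 v(1) xy(3) zr \<rho> by (intro sym) linarith+
      also have "\<dots> \<le> K * norm x powr \<alpha>"
        using 1 v K \<alpha> by (intro mult_left_mono powr_mono2) auto
      finally show ?thesis .
    qed
    have "\<bar>w x - w z\<bar> \<le> K * norm x powr \<alpha>" "\<bar>w y - w z\<bar> \<le> K * norm x powr \<alpha>"
      by (simp_all add: close)
    then show ?thesis by linarith
  qed
  have circ: "\<bar>w x - w y\<bar> \<le> 4 * K * norm x powr \<alpha>"
    if xy: "norm x = norm y" "norm x < \<rho> / 2" "x \<noteq> 0" for x y
  proof -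
    obtain z where z: "norm z = norm x" "x \<bullet> z = 0" "y \<bullet> z \<ge> 0" by (rule exists_orthogonal_same_norm)
    have "\<bar>w x - w z\<bar> \<le> 2 * K * norm x powr \<alpha>" "\<bar>w y - w z\<bar> \<le> 2 * K * norm y powr \<alpha>"
      using z xy by (intro hop; auto)+
    then show ?thesis unfolding xy(1) by linarith
  qed
  \<comment> \<open>Descending a ray by factors \<open>2 / 3\<close> produces errors in geometric
    progression with ratio \<open>\<theta>\<close>; \<open>D\<close> is the sum of the
    series.\<close>
  define \<theta> :: real where "\<theta> = (2 / 3) powr \<alpha>"
  have \<theta>: "\<theta> < 1" unfolding \<theta>_def using \<alpha> powr_less_mono2[of \<alpha> "2/3" 1] by simp
  define D where "D = K / (1 - \<theta>)"
  have D: "D * \<theta> + K = D" "D \<ge> K" "D > 0"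
  proof -
    show "D * \<theta> + K = D" using \<theta> unfolding D_def by (simp add: field_simps)
    show "D > 0" using K \<theta> unfolding D_def by simp
    then show "D \<ge> K" using \<open>D * \<theta> + K = D\<close> unfolding \<theta>_def by (smt (verit) mult_nonneg_nonneg powr_ge_zero)
  qed
  have step: "\<bar>w (t *\<^sub>R x) - w x\<bar> \<le> K * norm x powr \<alpha>"
    if "2 / 3 \<le> t" "t \<le> 1" "norm x < \<rho>" "x \<noteq> 0" for t x
  proof -
    have "t *\<^sub>R x - x = - ((1 - t) *\<^sub>R x)" by (simp add: algebra_simps)
    then have n: "norm (t *\<^sub>R x - x) = (1 - t) * norm x" using that by simp
    have "norm (t *\<^sub>R x) \<le> norm x" using that by (simp add: mult_left_le_one_le)
    then have "norm (t *\<^sub>R x) < \<rho>" using that by linarith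
    moreover have "norm (t *\<^sub>R x - x) < norm (t *\<^sub>R x)" "norm (t *\<^sub>R x - x) < norm x"
      unfolding n using that by simp_all
    ultimately have "\<bar>w (t *\<^sub>R x) - w x\<bar> \<le> K * norm (t *\<^sub>R x - x) powr \<alpha>"
      using that(3) by (intro sym)
    also have "\<dots> \<le> K * norm x powr \<alpha>"
      unfolding n using that K \<alpha> by (intro mult_left_mono powr_mono2) (auto simp: mult_left_le_one_le)
    finally show ?thesis .
  qed
  have radial_n: "\<bar>w (t *\<^sub>R x) - w x\<bar> \<le> D * norm x powr \<alpha>"
    if "(2 / 3) ^ n \<le> t" "t \<le> 1" "norm x < \<rho>" "x \<noteq> 0" for t x n
    using that
  proof (induction n arbitrary: t x)
    case 0
    then show ?case using D by simp
  next
    case (Suc n)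
    show ?case
    proof (cases "2 / 3 \<le> t")
      case True
      have "\<bar>w (t *\<^sub>R x) - w x\<bar> \<le> K * norm x powr \<alpha>" using step[OF True] Suc.prems by blast
      also have "\<dots> \<le> D * norm x powr \<alpha>" using D by (intro mult_right_mono) auto
      finally show ?thesis .
    next
      case False
      define x' where "x' = (2 / 3 :: real) *\<^sub>R x"
      have "\<bar>w ((3 / 2 * t) *\<^sub>R x') - w x'\<bar> \<le> D * norm x' powr \<alpha>"
      proof (rule Suc.IH)
        have "norm x' \<le> norm x" unfolding x'_def by simp
        then show "norm x' < \<rho>" using Suc.prems by linarith
      qed (use Suc.prems False in \<open>auto simp: x'_def\<close>)
      moreover have "norm x' powr \<alpha> = \<theta> * norm x powr \<alpha>" unfolding x'_def \<theta>_def by (simp flip: powr_mult)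
      moreover have "(3 / 2 * t) *\<^sub>R x' = t *\<^sub>R x" unfolding x'_def by simp
      moreover have "\<bar>w x' - w x\<bar> \<le> K * norm x powr \<alpha>"
        unfolding x'_def by (rule step) (use Suc.prems in auto)
      ultimately have "\<bar>w (t *\<^sub>R x) - w x\<bar> \<le> (D * \<theta> + K) * norm x powr \<alpha>"
        by (simp add: algebra_simps)
      then show ?thesis using D by simp
    qed
  qed
  define B where "B = D + 4 * K"
  have B: "B > 0" unfolding B_def using D K by simp
  have osc: "\<bar>w x - w y\<bar> \<le> B * norm x powr \<alpha>" if xy: "norm y \<le> norm x" "norm x < \<rho> / 2" "y \<noteq> 0" for x y
  proof -
    have x: "norm x > 0" "x \<noteq> 0" using xy by auto
    define t where "t = norm y / norm x"
    have t: "0 < t" "t \<le> 1" unfolding t_def using xy x by auto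
    obtain n where n: "(2 / 3) ^ n < t" using real_arch_pow_inv[OF t(1), of "2/3"] by auto
    have tn: "norm (t *\<^sub>R x) = norm y" unfolding t_def using x by simp
    have "\<bar>w (t *\<^sub>R x) - w x\<bar> \<le> D * norm x powr \<alpha>"
      using n t xy x \<rho> by (intro radial_n[of n]) auto
    moreover have "\<bar>w (t *\<^sub>R x) - w y\<bar> \<le> 4 * K * norm (t *\<^sub>R x) powr \<alpha>"
      using tn xy t x by (intro circ) auto
    moreover have "4 * K * norm (t *\<^sub>R x) powr \<alpha> \<le> 4 * K * norm x powr \<alpha>"
      unfolding tn using xy K \<alpha> by (intro mult_left_mono powr_mono2) auto
    ultimately show ?thesis unfolding B_def by (simp add: algebra_simps)
  qed
  \<comment> \<open>A sequence tending to the origin. The values of \<open>w\<close> along it are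
    bounded by \<open>osc\<close>, a subsequence of them converges, and \<open>osc\<close> shows its
    limit \<open>w0\<close> to be the limit of \<open>w\<close>.\<close>
  define s where "s = (\<lambda>n. (\<rho> / 4 * inverse (real (Suc n))) *\<^sub>R (axis 1 1 :: real^2))"
  have s: "norm (s n) = \<rho> / 4 * inverse (real (Suc n))" for n unfolding s_def using \<rho> by (simp add: norm_axis_1)
  have s0: "s n \<noteq> 0" for n unfolding s_def using \<rho> by simp
  have "bounded (range (\<lambda>n. w (s n)))"
  proof (rule boundedI)
    fix v assume "v \<in> range (\<lambda>n. w (s n))"
    then obtain n where v: "v = w (s n)" by auto
    have "norm (s n) \<le> norm (s 0)" "norm (s 0) < \<rho> / 2" unfolding s using \<rho> by (simp_all add: divide_simps)
    from osc[OF this s0] have "\<bar>w (s 0) - v\<bar> \<le> B * norm (s 0) powr \<alpha>" unfolding v .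
    then show "norm v \<le> \<bar>w (s 0)\<bar> + B * norm (s 0) powr \<alpha>" by simp
  qed
  then obtain w0 \<sigma> where \<sigma>: "strict_mono \<sigma>" "((\<lambda>n. w (s n)) \<circ> \<sigma>) \<longlonglongrightarrow> w0"
    using bounded_imp_convergent_subsequence by blast
  have "s \<longlonglongrightarrow> 0"
    by (rule tendsto_norm_zero_cancel) (unfold s, rule tendsto_mult_right_zero[OF LIMSEQ_inverse_real_of_nat])
  then have "(s \<circ> \<sigma>) \<longlonglongrightarrow> 0" using \<sigma>(1) LIMSEQ_subseq_LIMSEQ by blast
  then have s\<sigma>: "((\<lambda>n. norm (s (\<sigma> n))) \<longlongrightarrow> 0) sequentially" by (simp add: o_def tendsto_norm_zero)
  have w0: "\<bar>w x - w0\<bar> \<le> B * norm x powr \<alpha>" if x: "x \<noteq> 0" "norm x < \<rho> / 2" for x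
  proof -
    have "((\<lambda>n. \<bar>w x - w (s (\<sigma> n))\<bar>) \<longlongrightarrow> \<bar>w x - w0\<bar>) sequentially"
      using \<sigma>(2) by (intro tendsto_intros) (simp add: o_def)
    moreover have "eventually (\<lambda>n. norm (s (\<sigma> n)) < norm x) sequentially"
      using order_tendstoD(2)[OF s\<sigma>] x by simp
    then have "eventually (\<lambda>n. \<bar>w x - w (s (\<sigma> n))\<bar> \<le> B * norm x powr \<alpha>) sequentially"
      by eventually_elim (use osc x s0 in force)
    ultimately show ?thesis by (rule tendsto_upperbound) simp
  qed
  define C where "C = K + B * 3 powr \<alpha>"
  have CB: "B \<le> C" "K \<le> C" unfolding C_def using K B \<alpha> ge_one_powr_ge_zero[of 3 \<alpha>] by (auto intro: add_increasing)
  \<comment> \<open>If \<open>x - y\<close> is short compared with \<open>x\<close>, it is also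
    shorter than \<open>y\<close> and the local bound applies; otherwise
    \<open>norm x \<le> 3 * norm (x - y)\<close> and the oscillation bound suffices.\<close>
  have main: "\<bar>w x - w y\<bar> \<le> C * norm (x - y) powr \<alpha>"
    if xy: "norm y \<le> norm x" "norm x < \<rho> / 2" "y \<noteq> 0" for x y
  proof (cases "norm (x - y) < norm x / 3")
    case True
    have "norm x \<le> norm (x - y) + norm y" by (metis diff_add_cancel norm_triangle_ineq)
    with True xy have "\<bar>w x - w y\<bar> \<le> K * norm (x - y) powr \<alpha>"
      using \<rho> by (intro sym) auto
    also have "\<dots> \<le> C * norm (x - y) powr \<alpha>" using CB by (intro mult_right_mono) auto
    finally show ?thesis .
  next
    case False
    have "\<bar>w x - w y\<bar> \<le> B * norm x powr \<alpha>" by (rule osc[OF xy])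
    also have "\<dots> \<le> B * (3 * norm (x - y)) powr \<alpha>"
      using False B \<alpha> by (intro mult_left_mono powr_mono2) auto
    also have "\<dots> = B * 3 powr \<alpha> * norm (x - y) powr \<alpha>" by (simp add: powr_mult)
    also have "\<dots> \<le> C * norm (x - y) powr \<alpha>" unfolding C_def using K by (intro mult_right_mono) auto
    finally show ?thesis .
  qed
  have w0': "\<bar>w x - w0\<bar> \<le> C * norm x powr \<alpha>" if x: "x \<noteq> 0" "norm x < \<rho> / 2" for x
    using w0[OF x] CB(1) by (meson mult_right_mono order_trans powr_ge_zero)
  show ?thesis
  proof (rule exI[of _ C], rule exI[of _ w0], intro ballI)
    fix x y :: "real^2" assume xy: "x \<in> ball 0 (\<rho> / 2)" "y \<in> ball 0 (\<rho> / 2)"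
    show "\<bar>(w(0 := w0)) x - (w(0 := w0)) y\<bar> \<le> C * norm (x - y) powr \<alpha>"
    proof (cases "x = 0 \<or> y = 0")
      case True
      then show ?thesis using w0'[of x] w0'[of y] xy by (auto simp: abs_minus_commute)
    next
      case False
      then show ?thesis using main[of x y] main[of y x] xy
        by (cases "norm y \<le> norm x") (auto simp: abs_minus_commute norm_minus_commute)
    qed
  qed
qed

text \<open>Three kinds of pairs occur. Two points near the origin are covered by assumption, points
  at least \<open>r0 / 2\<close> apart by boundedness of \<open>v\<close>, and close points of which
  one is at least \<open>r0\<close> from the origin by the bounded gradient.\<close>

lemma hoelder_continuous_on_cball_glue:
  fixes u v :: "'a::euclidean_space \<Rightarrow> real"
  assumes cont: "continuous_on (cball 0 1 - {0}) u" and gcont: "continuous_on (cball 0 1 - {0}) g"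
    and grad: "\<And>x. x \<in> ball 0 1 - {0} \<Longrightarrow> GDERIV u x :> g x"
    and v: "\<And>x. x \<noteq> 0 \<Longrightarrow> v x = u x"
    and \<alpha>: "0 < \<alpha>" "\<alpha> \<le> 1" and r0: "0 < r0" "r0 \<le> 1"
    and near: "\<And>x y. x \<in> ball 0 r0 \<Longrightarrow> y \<in> ball 0 r0 \<Longrightarrow> \<bar>v x - v y\<bar> \<le> C * norm (x - y) powr \<alpha>"
  shows "hoelder_continuous_on (cball 0 1) v"
proof -
  \<comment> \<open>The inner radius \<open>r0 / 2\<close> leaves room for segments shorter than
    \<open>r0 / 2\<close> that start outside \<open>ball 0 r0\<close>.\<close>
  define A :: "'a set" where "A = cball 0 1 - ball 0 (r0 / 2)"
  have A: "compact A" "A \<subseteq> cball 0 1 - {0}"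
    unfolding A_def using r0 by (auto intro: compact_diff)
  have "bounded (g ` A)" "bounded (u ` A)"
    using A compact_continuous_image continuous_on_subset[OF gcont] continuous_on_subset[OF cont] compact_imp_bounded by blast+
  then obtain L0 B0 where L0: "\<And>x. x \<in> A \<Longrightarrow> norm (g x) \<le> L0" and B0: "\<And>x. x \<in> A \<Longrightarrow> \<bar>u x\<bar> \<le> B0"
    unfolding bounded_iff by auto
  define L where "L = max L0 0"
  have L: "\<And>x. x \<in> A \<Longrightarrow> norm (g x) \<le> L" "L \<ge> 0" using L0 unfolding L_def by (auto simp: le_max_iff_disj)
  define B where "B = max B0 0 + \<bar>v 0\<bar> + \<bar>C\<bar>"
  have B: "\<bar>v x\<bar> \<le> B" if "x \<in> cball 0 1" for x
  proof (cases "x \<in> ball 0 r0")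
    case True
    have "\<bar>v x - v 0\<bar> \<le> C * norm x powr \<alpha>" using near[OF True, of 0] r0 by simp
    also have "\<dots> \<le> \<bar>C\<bar> * 1"
      using that \<alpha> by (intro mult_mono powr_le1) auto
    finally show ?thesis unfolding B_def by linarith
  next
    case False
    then have "x \<in> A" "x \<noteq> 0" using that r0 unfolding A_def by auto
    then show ?thesis using B0[of x] v[of x] unfolding B_def by simp
  qed
  have lip: "\<bar>u x - u y\<bar> \<le> L * norm (x - y)"
    if x: "x \<in> cball 0 1" "y \<in> cball 0 1" "norm x \<ge> r0" "norm (x - y) < r0 / 2" "x \<noteq> y" for x y
  proof -
    define \<gamma> where "\<gamma> = (\<lambda>t::real. x + t *\<^sub>R (y - x))"
    have near_x: "norm (\<gamma> t) > r0 / 2" if t: "0 \<le> t" "t \<le> 1" for t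
    proof -
      have "norm (t *\<^sub>R (y - x)) \<le> norm (x - y)"
        using t by (simp add: norm_minus_commute mult_left_le_one_le)
      moreover have "norm x \<le> norm (\<gamma> t) + norm (t *\<^sub>R (y - x))"
        unfolding \<gamma>_def by (metis add_diff_cancel_right' norm_triangle_ineq4)
      ultimately show ?thesis using x by linarith
    qed
    have \<gamma>_conv: "\<gamma> t = (1 - t) *\<^sub>R x + t *\<^sub>R y" for t unfolding \<gamma>_def by (simp add: algebra_simps)
    have \<gamma>c: "\<gamma> t \<in> cball 0 1" if "0 \<le> t" "t \<le> 1" for t
      unfolding \<gamma>_conv using convexD[OF convex_cball x(1,2), of "1 - t" t] that by auto
    then have \<gamma>A: "\<gamma> t \<in> A" if "0 \<le> t" "t \<le> 1" for t using near_x[of t] that unfolding A_def by auto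
    \<comment> \<open>By strict convexity the open segment stays off the unit circle, so the mean
      value theorem uses derivatives only where they exist.\<close>
    have \<gamma>o: "\<gamma> t \<in> ball 0 1 - {0}" if "0 < t" "t < 1" for t
    proof -
      have "\<gamma> t \<in> open_segment x y" unfolding in_segment \<gamma>_conv using that x by auto
      from dist_decreases_open_segment[OF this, of 0] have "norm (\<gamma> t) < 1"
        using x by auto
      then show ?thesis using near_x[of t] that r0 by auto
    qed
    obtain t where t: "0 < t" "t < 1" "u (\<gamma> 1) - u (\<gamma> 0) = ((1 - 0) *\<^sub>R (y - x)) \<bullet> g (\<gamma> t)"
    proof (rule mvt[of 0 1 "\<lambda>t. u (\<gamma> t)" "\<lambda>t s. (s *\<^sub>R (y - x)) \<bullet> g (\<gamma> t)"])
      show "continuous_on {0..1} (\<lambda>t. u (\<gamma> t))"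
      proof (rule continuous_on_compose2[OF cont])
        show "continuous_on {0..1} \<gamma>" unfolding \<gamma>_def by (intro continuous_intros)
        show "\<gamma> ` {0..1} \<subseteq> cball 0 1 - {0}" using \<gamma>A A(2) by force
      qed
      fix t :: real assume t: "0 < t" "t < 1"
      have du: "(u has_derivative (\<lambda>h. h \<bullet> g (\<gamma> t))) (at (\<gamma> t))" using grad[OF \<gamma>o[OF t]] by (simp add: gderiv_def)
      show "((\<lambda>t. u (\<gamma> t)) has_derivative (\<lambda>s. (s *\<^sub>R (y - x)) \<bullet> g (\<gamma> t))) (at t)"
        by (rule has_derivative_compose[where g = u and f = \<gamma>, OF _ du])
          (auto simp: \<gamma>_def intro!: derivative_eq_intros)
    qed auto
    have "u y - u x = (y - x) \<bullet> g (\<gamma> t)" using t(3) unfolding \<gamma>_def by simp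
    then have "\<bar>u x - u y\<bar> = \<bar>(y - x) \<bullet> g (\<gamma> t)\<bar>" by linarith
    also have "\<dots> \<le> norm (y - x) * norm (g (\<gamma> t))" by (rule Cauchy_Schwarz_ineq2)
    also have "\<dots> \<le> norm (y - x) * L" using L(1)[OF \<gamma>A] t by (intro mult_left_mono) auto
    finally show ?thesis by (simp add: norm_minus_commute mult.commute)
  qed
  have lip': "\<bar>v x - v y\<bar> \<le> L * norm (x - y) powr \<alpha>"
    if x: "x \<in> cball 0 1" "y \<in> cball 0 1" "norm x \<ge> r0" "norm (x - y) < r0 / 2" for x y
  proof (cases "x = y")
    case False
    have "norm y \<ge> norm x - norm (x - y)" by (metis norm_minus_commute norm_triangle_ineq2 diff_le_eq add.commute le_diff_eq norm_triangle_sub)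
    then have "x \<noteq> 0" "y \<noteq> 0" using x r0 by auto
    then have "\<bar>v x - v y\<bar> \<le> L * norm (x - y)" using lip[OF x False] v by simp
    also have "norm (x - y) \<le> norm (x - y) powr \<alpha>"
      using powr_mono'[of \<alpha> 1 "norm (x - y)"] \<alpha> x r0 by auto
    then have "L * norm (x - y) \<le> L * norm (x - y) powr \<alpha>" using L by (intro mult_left_mono) auto
    finally show ?thesis .
  qed (use L in auto)
  define C' where "C' = \<bar>C\<bar> + L + 2 * B * (2 / r0) powr \<alpha>"
  have "B \<ge> 0" unfolding B_def by simp
  then have C': "C \<le> C'" "L \<le> C'" "2 * B * (2 / r0) powr \<alpha> \<le> C'"
    using L(2) mult_nonneg_nonneg[of "2 * B" "(2 / r0) powr \<alpha>"] powr_ge_zero[of "2 / r0" \<alpha>]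
    unfolding C'_def by linarith+
  have up: "c \<le> c' \<Longrightarrow> z \<le> c * norm p powr \<alpha> \<Longrightarrow> z \<le> c' * norm p powr \<alpha>" for c c' z :: real and p :: 'a
    by (meson mult_right_mono order_trans powr_ge_zero)
  have "\<bar>v x - v y\<bar> \<le> C' * norm (x - y) powr \<alpha>" if xy: "x \<in> cball 0 1" "y \<in> cball 0 1" for x y
  proof -
    consider "x \<in> ball 0 r0" "y \<in> ball 0 r0" | "norm (x - y) \<ge> r0 / 2"
      | "norm x \<ge> r0" "norm (x - y) < r0 / 2" | "norm y \<ge> r0" "norm (y - x) < r0 / 2"
      by (auto simp: norm_minus_commute) linarith
    then show ?thesis
    proof cases
      case 1
      then show ?thesis using near up[OF C'(1)] by blast
    next
      case 2
      have "1 = 1 powr \<alpha>" by simp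
      also have "\<dots> \<le> (2 / r0 * norm (x - y)) powr \<alpha>"
        using 2 r0 \<alpha> by (intro powr_mono2) (auto simp: field_simps)
      also have "\<dots> = (2 / r0) powr \<alpha> * norm (x - y) powr \<alpha>"
        by (rule powr_mult; use r0 in simp)
      finally have "2 * B * 1 \<le> 2 * B * ((2 / r0) powr \<alpha> * norm (x - y) powr \<alpha>)"
        using \<open>B \<ge> 0\<close> by (intro mult_left_mono) auto
      moreover have "\<bar>v x - v y\<bar> \<le> 2 * B" using B[OF xy(1)] B[OF xy(2)] by linarith
      ultimately have "\<bar>v x - v y\<bar> \<le> 2 * B * (2 / r0) powr \<alpha> * norm (x - y) powr \<alpha>" by (simp add: mult.assoc)
      then show ?thesis by (rule up[OF C'(3)])
    next
      case 3
      then show ?thesis using lip'[OF xy] up[OF C'(2)] by blast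
    next
      case 4
      then have "\<bar>v y - v x\<bar> \<le> C' * norm (y - x) powr \<alpha>" using lip'[OF xy(2,1)] up[OF C'(2)] by blast
      then show ?thesis by (simp add: abs_minus_commute norm_minus_commute)
    qed
  qed
  with \<alpha> show ?thesis unfolding hoelder_continuous_on_def dist_norm real_norm_def by blast
qed

section \<open>The two alternatives\<close>

text \<open>Identifies the comparison function of the linear bound at \<open>\<epsilon> = 0\<close>
  with \<open>|x|\<close>.\<close>

lemma powr_mult_square_powr:
  fixes t :: real
  assumes "t > 0"
  shows "t powr \<beta> * (t\<^sup>2) powr ((1 - \<beta>) / 2) = t"
proof -
  have "(t\<^sup>2) powr ((1 - \<beta>) / 2) = (t powr 2) powr ((1 - \<beta>) / 2)" using assms by (simp add: powr_numeral)
  also have "\<dots> = t powr (2 * ((1 - \<beta>) / 2))" by (rule powr_powr)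
  also have "2 * ((1 - \<beta>) / 2) = 1 - \<beta>" by simp
  finally show ?thesis using assms by (simp flip: powr_add)
qed

context punctured_solution
begin

text \<open>At a maximum of the quotient, \<open>- k\<close> times the logarithm of the comparison
  function, up to a constant, touches \<open>u\<close> from below. As \<open>ln |x|\<close> is
  harmonic off the origin, only the factor with \<open>\<epsilon>\<close> contributes to the
  Laplacian, at worst \<open>- 2 k / |x|^2\<close>; the factor \<open>|x|^\<beta>\<close> keeps the
  gradient at least \<open>k \<beta> / |x|\<close>.\<close>

lemma w_touch_below_log:
  assumes x0: "x0 \<in> \<Omega>" and \<beta>: "0 < \<beta>" "\<beta> \<le> 1" and \<epsilon>: "\<epsilon> > 0"
    and max: "eventually (\<lambda>x. w x / (norm x powr \<beta> * ((norm x)\<^sup>2 + \<epsilon>) powr ((1 - \<beta>) / 2))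
        \<le> w x0 / (norm x0 powr \<beta> * ((norm x0)\<^sup>2 + \<epsilon>) powr ((1 - \<beta>) / 2))) (nhds x0)"
  shows "m * (k * \<beta> / norm x0) powr q \<le> a * w x0 powr (- q) + 2 * k / (norm x0)\<^sup>2"
proof -
  define P where "P = (\<lambda>s. - (k / 2) * (\<beta> * ln s + (1 - \<beta>) * ln (s + \<epsilon>)))"
  define P1 where "P1 = (\<lambda>s. - (k / 2) * (\<beta> / s + (1 - \<beta>) / (s + \<epsilon>)))"
  define P2 where "P2 = (\<lambda>s. (k / 2) * (\<beta> / s\<^sup>2 + (1 - \<beta>) / (s + \<epsilon>)\<^sup>2))"
  define r where "r = norm x0"
  have r: "r > 0" using x0 unfolding r_def by auto
  have "4 * P1 (r\<^sup>2) + 4 * r\<^sup>2 * P2 (r\<^sup>2) + m * (2 * r * \<bar>P1 (r\<^sup>2)\<bar>) powr q \<le> a * exp (b * u x0)"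
    unfolding r_def
  proof (rule touch_below[OF x0, where y = 0 and S = "{0<..}" and P = P and ?P1.0 = P1 and ?P2.0 = P2, unfolded diff_zero])
    fix s :: real assume s: "s \<in> {0<..}"
    then have s: "s > 0" "s + \<epsilon> > 0" using \<epsilon> by auto
    have d1: "((\<lambda>s. ln (s + \<epsilon>)) has_field_derivative 1 / (s + \<epsilon>)) (at s)"
      using s by (auto intro!: derivative_eq_intros)
    from DERIV_cmult[OF DERIV_add[OF DERIV_cmult[OF DERIV_ln_divide[OF s(1)], of \<beta>] DERIV_cmult[OF d1, of "1 - \<beta>"]], of "- (k / 2)"]
    show "(P has_field_derivative P1 s) (at s)"
      unfolding P_def P1_def by (rule DERIV_cong) simp
    have d2: "((\<lambda>s. c / (s + e)) has_field_derivative - (c / (s + e)\<^sup>2)) (at s)" if "s + e > 0" for c e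
      using that by (auto intro!: derivative_eq_intros simp: power2_eq_square)
    from DERIV_cmult[OF DERIV_add[OF d2[of 0 \<beta>] d2[OF s(2), of "1 - \<beta>"]], of "- (k / 2)"] s
    show "(P1 has_field_derivative P2 s) (at s)"
      unfolding P1_def P2_def by (simp add: algebra_simps)
  next
    show "continuous_on {0<..} P2" unfolding P2_def using \<epsilon> by (intro continuous_intros) auto
    have "eventually (\<lambda>x. x \<in> \<Omega>) (nhds x0)" by (rule eventually_nhds_in_open) (use x0 in auto)
    with max show "eventually (\<lambda>x. u x - P ((norm x)\<^sup>2) \<ge> u x0 - P ((norm x0)\<^sup>2)) (nhds x0)"
    proof eventually_elim
      case (elim x)
      have key: "ln (w x / (norm x powr \<beta> * ((norm x)\<^sup>2 + \<epsilon>) powr ((1 - \<beta>) / 2))) = - (u x - P ((norm x)\<^sup>2)) / k"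
        if "x \<noteq> 0" for x
      proof -
        have "(norm x)\<^sup>2 + \<epsilon> > 0" using \<epsilon> by (simp add: add_nonneg_pos)
        then have "ln (w x / (norm x powr \<beta> * ((norm x)\<^sup>2 + \<epsilon>) powr ((1 - \<beta>) / 2)))
          = ln (w x) - (\<beta> * ln (norm x) + (1 - \<beta>) / 2 * ln ((norm x)\<^sup>2 + \<epsilon>))"
          using that w_pos[of x] by (simp add: ln_div ln_mult ln_powr)
        also have "ln (w x) = - u x / k" using u_eq_ln_w[of x] k_pos by simp
        also have "ln ((norm x)\<^sup>2) = 2 * ln (norm x)" using that by (simp add: ln_realpow)
        then have "\<beta> * ln (norm x) + (1 - \<beta>) / 2 * ln ((norm x)\<^sup>2 + \<epsilon>) = - P ((norm x)\<^sup>2) / k"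
          unfolding P_def using k_pos by (simp add: field_simps)
        finally show ?thesis using k_pos by (simp add: field_simps)
      qed
      have "x \<noteq> 0" "x0 \<noteq> 0" using elim x0 by auto
      have pos': "0 < w z / (norm z powr \<beta> * ((norm z)\<^sup>2 + \<epsilon>) powr ((1 - \<beta>) / 2))" if "z \<noteq> 0" for z
      proof -
        have "(norm z)\<^sup>2 + \<epsilon> > 0" using \<epsilon> by (simp add: add_nonneg_pos)
        then show ?thesis using w_pos[of z] that by simp
      qed
      from elim(1) have "- (u x - P ((norm x)\<^sup>2)) / k \<le> - (u x0 - P ((norm x0)\<^sup>2)) / k"
        unfolding key[OF \<open>x \<noteq> 0\<close>, symmetric] key[OF \<open>x0 \<noteq> 0\<close>, symmetric]
        using pos'[OF \<open>x \<noteq> 0\<close>] by (intro ln_mono)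
      then show ?case using k_pos by (simp add: divide_le_cancel)
    qed
  qed (use r in \<open>auto simp: r_def\<close>)
  then have main: "4 * P1 (r\<^sup>2) + 4 * r\<^sup>2 * P2 (r\<^sup>2) + m * (2 * r * \<bar>P1 (r\<^sup>2)\<bar>) powr q \<le> a * w x0 powr (- q)"
    by (simp add: exp_bu)
  define s where "s = r\<^sup>2"
  have s: "s > 0" "s + \<epsilon> > 0" using r \<epsilon> unfolding s_def by (auto intro: add_pos_pos)
  have "4 * P1 s = - 2 * k * (\<beta> / s + (1 - \<beta>) * (1 / (s + \<epsilon>)))" unfolding P1_def by simp
  moreover have "4 * s * P2 s = 2 * k * (s * (\<beta> / s\<^sup>2) + (1 - \<beta>) * (s / (s + \<epsilon>)\<^sup>2))"
  proof -
    have "4 * s * ((k / 2) * (A + B)) = 2 * k * (s * A + s * B)" for A B by (simp add: algebra_simps)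
    moreover have "s * ((1 - \<beta>) / (s + \<epsilon>)\<^sup>2) = (1 - \<beta>) * (s / (s + \<epsilon>)\<^sup>2)" by simp
    ultimately show ?thesis unfolding P2_def by (simp only:)
  qed
  moreover have "s * (\<beta> / s\<^sup>2) = \<beta> / s" using s by (simp add: power2_eq_square)
  moreover have "- 2 * k * (X + (1 - \<beta>) * Y) + 2 * k * (X + (1 - \<beta>) * Z) = - 2 * k * (1 - \<beta>) * (Y - Z)" for X Y Z
    by (simp add: algebra_simps)
  ultimately have "4 * P1 s + 4 * s * P2 s = - 2 * k * (1 - \<beta>) * (1 / (s + \<epsilon>) - s / (s + \<epsilon>)\<^sup>2)"
    by (simp only:)
  also have "1 / (s + \<epsilon>) - s / (s + \<epsilon>)\<^sup>2 = \<epsilon> / (s + \<epsilon>)\<^sup>2"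
    using s by (simp add: power2_eq_square divide_simps)
  finally have e1: "4 * P1 s + 4 * s * P2 s = - (2 * k * ((1 - \<beta>) * (\<epsilon> / (s + \<epsilon>)\<^sup>2)))" by simp
  have "(1 - \<beta>) * (\<epsilon> / (s + \<epsilon>)\<^sup>2) \<le> 1 * (1 / s)"
  proof (intro mult_mono)
    have "\<epsilon> * s \<le> (s + \<epsilon>)\<^sup>2" using s \<epsilon> by (simp add: power2_eq_square algebra_simps)
    then show "\<epsilon> / (s + \<epsilon>)\<^sup>2 \<le> 1 / s" using s by (simp add: divide_simps)
  qed (use \<beta> \<epsilon> in auto)
  then have e2: "- (2 * k / s) \<le> 4 * P1 s + 4 * s * P2 s"
    unfolding e1 using mult_left_mono[of _ "1 * (1 / s)" "2 * k"] k_pos by fastforce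
  have "k * \<beta> / r \<le> 2 * r * \<bar>P1 s\<bar>"
  proof -
    have "\<beta> / s \<le> \<beta> / s + (1 - \<beta>) / (s + \<epsilon>)" using \<beta> s by simp
    then have "r * (k * (\<beta> / s)) \<le> r * (k * (\<beta> / s + (1 - \<beta>) / (s + \<epsilon>)))"
      using r k_pos by (intro mult_left_mono) auto
    also have "\<dots> \<le> r * (2 * \<bar>P1 s\<bar>)"
    proof (intro mult_left_mono)
      have "2 * \<bar>P1 s\<bar> = \<bar>k * (\<beta> / s + (1 - \<beta>) / (s + \<epsilon>))\<bar>" unfolding P1_def by (simp add: abs_mult)
      then show "k * (\<beta> / s + (1 - \<beta>) / (s + \<epsilon>)) \<le> 2 * \<bar>P1 s\<bar>" by linarith
    qed (use r in simp)
    finally show ?thesis using r unfolding s_def by (simp add: power2_eq_square mult_ac)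
  qed
  then have "(k * \<beta> / r) powr q \<le> (2 * r * \<bar>P1 s\<bar>) powr q"
    using k_pos \<beta> r q by (intro powr_mono2) auto
  then have "m * (k * \<beta> / r) powr q \<le> m * (2 * r * \<bar>P1 s\<bar>) powr q" using m by simp
  with main e2 show ?thesis unfolding s_def r_def by linarith
qed

text \<open>The factor \<open>|x|\<^sup>\<beta>\<close> with \<open>\<beta> < \<alpha>\<close> keeps the gradient of the comparison function of order \<open>1/|x|\<close>
  uniformly in \<open>\<epsilon>\<close>, and still lets the quotient with \<open>w = O(|x|\<^sup>\<alpha>)\<close> vanish at the origin.\<close>

lemma w_le_linear:
  assumes \<rho>: "0 < \<rho>" "\<rho> < 1" and D: "\<And>x. x \<noteq> 0 \<Longrightarrow> norm x < \<rho> \<Longrightarrow> w x \<le> D * norm x powr \<alpha>"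
  shows "\<exists>C r1. C > 0 \<and> r1 > 0 \<and> (\<forall>x. x \<noteq> 0 \<and> norm x \<le> r1 \<longrightarrow> w x \<le> C * norm x)"
proof -
  define \<beta> where "\<beta> = \<alpha> / 2"
  have \<beta>: "0 < \<beta>" "\<beta> < 1" "\<beta> < \<alpha>" using \<alpha> unfolding \<beta>_def by auto
  define M where "M = m * (k * \<beta>) powr q"
  have M: "M > 0" unfolding M_def using m k_pos \<beta> by simp
  \<comment> \<open>For \<open>r \<le> r1\<close> the Laplacian term \<open>2 k / r^2\<close> is at
    most half of the gradient term \<open>M r^(-q)\<close>, because \<open>q > 2\<close>.\<close>
  define r1 where "r1 = min (\<rho> / 2) ((M / (4 * k)) powr (1 / (q - 2)))"
  have r1: "0 < r1" "r1 < \<rho>" "r1 < 1" using \<rho> M k_pos unfolding r1_def by (auto simp: min_def)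
  have r1q: "r powr (q - 2) \<le> M / (4 * k)" if "0 < r" "r \<le> r1" for r
  proof -
    have "r powr (q - 2) \<le> ((M / (4 * k)) powr (1 / (q - 2))) powr (q - 2)"
      using that q unfolding r1_def by (intro powr_mono2) auto
    then show ?thesis using q M k_pos by (simp add: powr_powr)
  qed
  define C0 where "C0 = (2 * a / M) powr (1 / q)"
  have C0: "C0 > 0" unfolding C0_def using a M by simp
  \<comment> \<open>\<open>C0\<close> is what the touching inequality gives at an interior maximum;
    \<open>1 / r1\<close> covers the circle \<open>norm x = r1\<close>, where
    \<open>w < 1\<close>.\<close>
  define C where "C = max C0 (1 / r1)"
  have C: "C > 0" "C0 \<le> C" "1 / r1 \<le> C" unfolding C_def using C0 by auto
  have bound: "w x \<le> C * (norm x powr \<beta> * ((norm x)\<^sup>2 + \<epsilon>) powr ((1 - \<beta>) / 2))"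
    if \<epsilon>: "\<epsilon> > 0" and x: "x \<noteq> 0" "norm x \<le> r1" for \<epsilon> x
  proof -
    define F where "F = (\<lambda>x::real^2. norm x powr \<beta> * ((norm x)\<^sup>2 + \<epsilon>) powr ((1 - \<beta>) / 2))"
    have F0: "F x > 0" if "x \<noteq> 0" for x
    proof -
      have "(norm x)\<^sup>2 + \<epsilon> > 0" using \<epsilon> by (simp add: add_nonneg_pos)
      then show ?thesis unfolding F_def using that by simp
    qed
    have Fge: "norm x \<le> F x" if "x \<noteq> 0" for x
    proof -
      have "norm x = norm x powr \<beta> * ((norm x)\<^sup>2) powr ((1 - \<beta>) / 2)"
        using that by (simp add: powr_mult_square_powr)
      also have "\<dots> \<le> F x" unfolding F_def using \<epsilon> \<beta> by (intro mult_left_mono powr_mono2) auto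
      finally show ?thesis .
    qed
    \<comment> \<open>The value 0 makes the quotient continuous at the origin, because
      \<open>w = O(|x|^\<alpha>)\<close> and \<open>\<beta> < \<alpha>\<close>. So it has a maximum
      on the closed disk, and that is not at the origin.\<close>
    define G where "G = (\<lambda>x. if x = 0 then 0 else w x / F x)"
    have Gc0: "isCont G 0"
    proof -
      have ev: "eventually (\<lambda>x. norm (G x) \<le> D * norm x powr (\<alpha> - \<beta>) * (1 / \<epsilon> powr ((1 - \<beta>) / 2))) (at 0)"
        unfolding eventually_at
      proof (intro exI[of _ \<rho>] conjI ballI impI \<rho>)
        fix x :: "real^2" assume "x \<noteq> 0 \<and> dist x 0 < \<rho>"
        then have x: "x \<noteq> 0" "norm x < \<rho>" by auto
        have "\<epsilon> powr ((1 - \<beta>) / 2) \<le> ((norm x)\<^sup>2 + \<epsilon>) powr ((1 - \<beta>) / 2)"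
          using \<epsilon> \<beta> by (intro powr_mono2) auto
        then have "norm x powr \<beta> * \<epsilon> powr ((1 - \<beta>) / 2) \<le> F x"
          unfolding F_def by (intro mult_left_mono) auto
        then have "w x / F x \<le> (D * norm x powr \<alpha>) / (norm x powr \<beta> * \<epsilon> powr ((1 - \<beta>) / 2))"
          using D[OF x] w_pos[of x] x \<epsilon> by (intro frac_le) auto
        also have "\<dots> = D * norm x powr (\<alpha> - \<beta>) * (1 / \<epsilon> powr ((1 - \<beta>) / 2))"
          by (simp add: powr_diff)
        finally show "norm (G x) \<le> D * norm x powr (\<alpha> - \<beta>) * (1 / \<epsilon> powr ((1 - \<beta>) / 2))"
          using x w_pos[of x] F0[of x] unfolding G_def by simp
      qed
      have "((\<lambda>x::real^2. norm x powr (\<alpha> - \<beta>)) \<longlongrightarrow> 0 powr (\<alpha> - \<beta>)) (at 0)"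
        by (rule tendsto_powr'[OF tendsto_norm_zero[OF tendsto_ident_at] tendsto_const]) (use \<beta> in auto)
      then have "((\<lambda>x::real^2. D * norm x powr (\<alpha> - \<beta>) * (1 / \<epsilon> powr ((1 - \<beta>) / 2))) \<longlongrightarrow> D * 0 powr (\<alpha> - \<beta>) * (1 / \<epsilon> powr ((1 - \<beta>) / 2))) (at 0)"
        by (intro tendsto_mult tendsto_const)
      then have "((\<lambda>x::real^2. D * norm x powr (\<alpha> - \<beta>) * (1 / \<epsilon> powr ((1 - \<beta>) / 2))) \<longlongrightarrow> 0) (at 0)"
        by simp
      from Lim_null_comparison[OF ev this] have "(G \<longlongrightarrow> 0) (at 0)" .
      moreover have "G 0 = 0" by (simp add: G_def)
      ultimately show ?thesis unfolding isCont_def by simp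
    qed
    have Gc: "continuous_on (cball 0 r1) G"
    proof (rule continuous_at_imp_continuous_on, rule ballI)
      fix x :: "real^2" assume x: "x \<in> cball 0 r1"
      show "isCont G x"
      proof (cases "x = 0")
        case False
        have "(norm y)\<^sup>2 + \<epsilon> \<noteq> 0" for y :: "real^2"
          using \<epsilon> zero_le_power2[of "norm y"] by linarith
        then have Fc: "continuous_on (ball 0 1 - {0}) F"
          unfolding F_def by (intro continuous_intros) auto
        have wc: "continuous_on (ball 0 1 - {0}) w"
          by (rule continuous_on_subset[OF w_cont]) auto
        have "\<forall>x\<in>ball 0 1 - {0}. F x \<noteq> 0"
          using F0 by (metis DiffD2 less_irrefl singletonI)
        with wc Fc have "continuous_on (ball 0 1 - {0}) (\<lambda>x. w x / F x)"
          by (rule continuous_on_divide)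
        then have "continuous_on (ball 0 1 - {0}) G" unfolding G_def by (rule continuous_on_eq) auto
        moreover have "open (ball (0::real^2) 1 - {0})" by auto
        ultimately show ?thesis using x False r1 by (simp add: continuous_on_eq_continuous_at)
      qed (use Gc0 in simp)
    qed
    have "cball (0::real^2) r1 \<noteq> {}" using r1 by auto
    with Gc obtain x0 where x0: "x0 \<in> cball 0 r1" "\<And>x. x \<in> cball 0 r1 \<Longrightarrow> G x \<le> G x0"
      using continuous_attains_sup[OF compact_cball] by blast
    have "G x > 0" using x F0 w_pos unfolding G_def by simp
    with x0(2)[of x] x have "G x0 > 0" by auto
    then have nz: "x0 \<noteq> 0" unfolding G_def by auto
    then have x0\<Omega>: "x0 \<in> \<Omega>" using x0(1) r1 by auto
    have "G x0 \<le> C"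
    proof (cases "norm x0 = r1")
      case True
      have "w x0 / F x0 \<le> 1 / r1"
        using w_less_1[OF x0\<Omega>] w_pos[of x0] Fge[OF nz] True r1 by (intro frac_le) auto
      then show ?thesis using nz C unfolding G_def by simp
    next
      case False
      then have x0b: "x0 \<in> ball 0 r1 - {0}" using x0(1) nz by auto
      define r where "r = norm x0"
      have r: "0 < r" "r \<le> r1" using x0b unfolding r_def by auto
      have "eventually (\<lambda>x. x \<in> ball 0 r1 - {0}) (nhds x0)"
        by (rule eventually_nhds_in_open) (use x0b in auto)
      then have "eventually (\<lambda>x. w x / F x \<le> w x0 / F x0) (nhds x0)"
      proof eventually_elim
        case (elim x)
        then show ?case using x0(2)[of x] nz unfolding G_def by auto
      qed
      from w_touch_below_log[OF x0\<Omega> \<beta>(1) _ \<epsilon> this[unfolded F_def]] \<beta>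
      have 1: "m * (k * \<beta> / r) powr q \<le> a * w x0 powr (- q) + 2 * k / r\<^sup>2" unfolding r_def by simp
      have "m * (k * \<beta> / r) powr q = M * r powr (- q)"
        unfolding M_def using r k_pos \<beta> by (simp add: powr_divide powr_minus_divide)
      moreover have "2 * k / r\<^sup>2 \<le> M / 2 * r powr (- q)"
      proof -
        have "2 * k / r\<^sup>2 = 2 * k * r powr (q - 2) * r powr (- q)"
          using r by (simp add: powr_minus powr_diff powr_numeral field_simps)
        also have "\<dots> \<le> 2 * k * (M / (4 * k)) * r powr (- q)"
          using r1q[OF r] k_pos by (intro mult_right_mono mult_left_mono) auto
        finally show ?thesis using k_pos by simp
      qed
      ultimately have "M / 2 * r powr (- q) \<le> a * w x0 powr (- q)" using 1 by linarith
      then have "w x0 powr q * (M / 2 * r powr (- q)) * r powr q \<le> w x0 powr q * (a * w x0 powr (- q)) * r powr q"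
        by (intro mult_left_mono mult_right_mono) auto
      then have "w x0 powr q * (M / 2) \<le> a * r powr q"
        using r w_pos[of x0] by (simp add: powr_minus field_simps)
      then have "w x0 powr q \<le> (2 * a / M) * r powr q" using M by (simp add: field_simps)
      also have "\<dots> = (C0 * r) powr q"
        unfolding C0_def using a M r q by (simp add: powr_mult powr_powr)
      finally have "w x0 \<le> C0 * r"
        using w_pos[of x0] C0 r q by (smt (verit) powr_less_mono2 mult_pos_pos)
      also have "\<dots> \<le> C0 * F x0" using Fge[OF nz] C0 unfolding r_def by simp
      finally have "w x0 / F x0 \<le> C0" using F0[OF nz] by (simp add: divide_simps)
      then show ?thesis using nz C unfolding G_def by simp
    qed
    with x0(2)[of x] x have "G x \<le> C" by simp
    then have "w x / F x \<le> C" using x unfolding G_def by simp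
    then have "w x \<le> C * F x" using F0[of x] x by (simp add: divide_simps)
    then show ?thesis unfolding F_def .
  qed
  \<comment> \<open>\<open>C\<close> and \<open>r1\<close> do not depend on
    \<open>\<epsilon>\<close>, which can therefore tend to 0.\<close>
  have "w x \<le> C * norm x" if x: "x \<noteq> 0" "norm x \<le> r1" for x
  proof -
    have "((\<lambda>\<epsilon>. C * (norm x powr \<beta> * ((norm x)\<^sup>2 + \<epsilon>) powr ((1 - \<beta>) / 2))) \<longlongrightarrow>
        C * (norm x powr \<beta> * ((norm x)\<^sup>2 + 0) powr ((1 - \<beta>) / 2))) (at_right 0)"
      using x by (intro tendsto_intros) auto
    moreover have "eventually (\<lambda>\<epsilon>. w x \<le> C * (norm x powr \<beta> * ((norm x)\<^sup>2 + \<epsilon>) powr ((1 - \<beta>) / 2))) (at_right 0)"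
      unfolding eventually_at_right_field by (rule exI[of _ 1]) (use bound[OF _ x] in auto)
    ultimately have "w x \<le> C * (norm x powr \<beta> * ((norm x)\<^sup>2 + 0) powr ((1 - \<beta>) / 2))"
      by (rule tendsto_lowerbound) simp
    also have "norm x powr \<beta> * ((norm x)\<^sup>2 + 0) powr ((1 - \<beta>) / 2) = norm x"
      using x by (simp add: powr_mult_square_powr)
    finally show ?thesis .
  qed
  then show ?thesis using C r1 by blast
qed

text \<open>The linear upper bound on \<open>w\<close> bounds \<open>u + k ln |x|\<close> from
  below, and \<open>exp_u_le\<close> bounds it from above. Division by \<open>- ln |x|\<close>,
  which tends to infinity, removes both constants.\<close>

lemma log_limit:
  assumes C: "C > 0" and r1: "r1 > 0" and le: "\<And>x. x \<noteq> 0 \<Longrightarrow> norm x \<le> r1 \<Longrightarrow> w x \<le> C * norm x"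
  shows "((\<lambda>x. u x / (- ln (norm x))) \<longlongrightarrow> k) (at 0)"
proof -
  obtain C' where C': "C' > 0" "\<And>y. 0 < norm y \<Longrightarrow> norm y < 1/2 \<Longrightarrow> exp (u y / k) * norm y \<le> C'"
    using exp_u_le by blast
  have inf: "filterlim (\<lambda>x::real^2. - ln (norm x)) at_top (at 0)"
    unfolding filterlim_uminus_at_top minus_minus
    by (rule filterlim_compose[OF ln_at_0]) (auto simp: filterlim_at eventually_at_filter intro!: tendsto_norm_zero tendsto_ident_at)
  have lim: "((\<lambda>x::real^2. k * (c / (- ln (norm x)) + 1)) \<longlongrightarrow> k * (0 + 1)) (at 0)" for c
    by (intro tendsto_mult tendsto_add tendsto_const tendsto_divide_0[OF tendsto_const]
        filterlim_at_top_imp_at_infinity inf)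
  have ev: "eventually (\<lambda>x::real^2. x \<noteq> 0 \<and> norm x < min r1 (1 / 2)) (at 0)"
    unfolding eventually_at using r1 by (intro exI[of _ "min r1 (1 / 2)"]) auto
  have lo: "k * (- ln C / (- ln (norm x)) + 1) \<le> u x / (- ln (norm x))"
    and hi: "u x / (- ln (norm x)) \<le> k * (ln C' / (- ln (norm x)) + 1)"
    if x: "x \<noteq> 0" "norm x < min r1 (1 / 2)" for x
  proof -
    have n: "- ln (norm x) > 0" using x by (simp add: ln_less_zero)
    have "ln (w x) \<le> ln (C * norm x)" using le[of x] x w_pos[of x] by (intro ln_mono) auto
    then have "ln (w x) \<le> ln C + ln (norm x)" using C x by (simp add: ln_mult)
    then have "k * ln (w x) \<le> k * (ln C + ln (norm x))" using k_pos by (intro mult_left_mono) auto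
    then have "u x \<ge> k * (- ln C + (- ln (norm x)))" using u_eq_ln_w[of x] by (simp add: algebra_simps)
    then have "u x / (- ln (norm x)) \<ge> k * (- ln C + (- ln (norm x))) / (- ln (norm x))"
      using n by (intro divide_right_mono) auto
    also have "k * (- ln C + (- ln (norm x))) / (- ln (norm x)) = k * (- ln C / (- ln (norm x)) + 1)"
      using n by (simp add: field_simps)
    finally show "k * (- ln C / (- ln (norm x)) + 1) \<le> u x / (- ln (norm x))" .
    have "ln (exp (u x / k) * norm x) \<le> ln C'" using C'(2)[of x] x by (intro ln_mono) auto
    then have "u x / k + ln (norm x) \<le> ln C'" using x by (simp add: ln_mult)
    then have "u x \<le> k * (ln C' + (- ln (norm x)))" using k_pos by (simp add: field_simps)
    then have "u x / (- ln (norm x)) \<le> k * (ln C' + (- ln (norm x))) / (- ln (norm x))"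
      using n by (intro divide_right_mono) auto
    also have "k * (ln C' + (- ln (norm x))) / (- ln (norm x)) = k * (ln C' / (- ln (norm x)) + 1)"
      using n by (simp add: field_simps)
    finally show "u x / (- ln (norm x)) \<le> k * (ln C' / (- ln (norm x)) + 1)" .
  qed
  have "((\<lambda>x. u x / (- ln (norm x))) \<longlongrightarrow> k * (0 + 1)) (at 0)"
    by (rule tendsto_sandwich[OF _ _ lim[of "- ln C"] lim[of "ln C'"]])
      (use ev in \<open>eventually_elim; use lo hi in blast\<close>)+
  then show ?thesis by simp
qed

text \<open>The logarithm is Lipschitz on \<open>[w0/2, \<infinity>)\<close>, so
  \<open>u = - k ln w\<close> inherits the estimate where \<open>w \<ge> w0/2\<close>; gluing covers
  the rest of the disk.\<close>

lemma hoelder_case: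
  assumes w0: "w0 > 0" and r: "0 < r" "r \<le> 1"
    and H: "\<And>x y. x \<in> ball 0 r \<Longrightarrow> y \<in> ball 0 r \<Longrightarrow> \<bar>(w(0 := w0)) x - (w(0 := w0)) y\<bar> \<le> C * norm (x - y) powr \<alpha>"
  shows "hoelder_continuous_on (cball 0 1) (u(0 := - k * ln w0))"
proof -
  define v where "v = u(0 := - k * ln w0)"
  define W where "W = w(0 := w0)"
  have vW: "v x = - k * ln (W x)" for x unfolding v_def W_def by (auto simp: u_eq_ln_w)
  \<comment> \<open>Ensures \<open>(|C| + 1) r0^\<alpha> \<le> w0 / 2\<close>; the summand 1 keeps
    the denominator positive when \<open>C = 0\<close>.\<close>
  define r0 where "r0 = min r ((w0 / (2 * (\<bar>C\<bar> + 1))) powr (1 / \<alpha>))"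
  have r0: "0 < r0" "r0 \<le> r" "r0 \<le> 1" unfolding r0_def using r w0 by auto
  have low: "W x \<ge> w0 / 2" if "x \<in> ball 0 r0" for x
  proof -
    have "\<bar>W x - W 0\<bar> \<le> C * norm (x - 0) powr \<alpha>"
      unfolding W_def by (rule H) (use that r r0 in auto)
    also have "\<dots> \<le> (\<bar>C\<bar> + 1) * r0 powr \<alpha>"
      using that \<alpha> by (intro mult_mono powr_mono2) auto
    also have "\<dots> \<le> (\<bar>C\<bar> + 1) * ((w0 / (2 * (\<bar>C\<bar> + 1))) powr (1 / \<alpha>)) powr \<alpha>"
      using \<alpha> r0 unfolding r0_def by (intro mult_left_mono powr_mono2) auto
    also have "\<dots> = (\<bar>C\<bar> + 1) * (w0 / (2 * (\<bar>C\<bar> + 1)))" using \<alpha> w0 by (simp add: powr_powr)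
    also have "\<dots> = w0 / 2"
    proof -
      have "c * (w0 / (2 * c)) = w0 / 2" if "c > 0" for c :: real using that by simp
      then show ?thesis by this simp
    qed
    finally have "\<bar>W x - w0\<bar> \<le> w0 / 2" unfolding W_def by simp
    then show ?thesis by linarith
  qed
  have ln_lip: "ln p - ln p' \<le> 2 / w0 * \<bar>p - p'\<bar>" if "p \<ge> w0 / 2" "p' \<ge> w0 / 2" for p p'
  proof -
    have p: "p > 0" "p' > 0" using that w0 by auto
    have "ln p - ln p' = ln (p / p')" using p by (simp add: ln_div)
    also have "\<dots> \<le> p / p' - 1" using p by (intro ln_le_minus_one) auto
    also have "\<dots> = (p - p') / p'" using p by (simp add: field_simps)
    also have "\<dots> \<le> \<bar>p - p'\<bar> / (w0 / 2)" using that p w0 by (intro frac_le) auto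
    finally show ?thesis by (simp add: mult.commute)
  qed
  have "hoelder_continuous_on (cball 0 1) v"
  proof (rule hoelder_continuous_on_cball_glue[OF cont gcont grad _ \<alpha>(1) _ r0(1,3)])
    fix x y :: "real^2" assume xy: "x \<in> ball 0 r0" "y \<in> ball 0 r0"
    have "\<bar>v x - v y\<bar> = k * \<bar>ln (W x) - ln (W y)\<bar>"
      unfolding vW using k_pos by (simp add: abs_mult abs_minus_commute flip: right_diff_distrib)
    also have "\<dots> \<le> k * (2 / w0 * \<bar>W x - W y\<bar>)"
      using ln_lip[OF low[OF xy(1)] low[OF xy(2)]] ln_lip[OF low[OF xy(2)] low[OF xy(1)]] k_pos
      by (intro mult_left_mono) (auto simp: abs_le_iff abs_minus_commute)
    also have "\<dots> \<le> k * (2 / w0 * (C * norm (x - y) powr \<alpha>))"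
      unfolding W_def using H[of x y] xy r0 k_pos w0 by (intro mult_left_mono) auto
    finally show "\<bar>v x - v y\<bar> \<le> (k * 2 / w0 * C) * norm (x - y) powr \<alpha>" by simp
  qed (use \<alpha> in \<open>auto simp: v_def\<close>)
  then show ?thesis unfolding v_def .
qed

lemma dichotomy:
  "((\<lambda>x. u x / (- ln (norm x))) \<longlongrightarrow> q / b) (at 0) \<or>
    (\<exists>v. (\<forall>x\<in>cball 0 1 - {0}. v x = u x) \<and> hoelder_continuous_on (cball 0 1) v)"
proof -
  obtain K where K: "K > 0" "\<And>x y. norm y < 1/2 \<Longrightarrow> norm (x - y) < norm y \<Longrightarrow> w x \<le> w y + K * norm (x - y) powr \<alpha>"
    using w_local_bound by blast
  have "\<exists>C w0. \<forall>x\<in>ball 0 (1 / 2 / 2). \<forall>y\<in>ball 0 (1 / 2 / 2).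
      \<bar>(w(0 := w0)) x - (w(0 := w0)) y\<bar> \<le> C * norm (x - y) powr \<alpha>"
    by (rule hoelder_punctured_from_local[OF K(1) \<alpha>(1) _ K(2)]) auto
  then obtain C w0 where "\<forall>x\<in>ball 0 (1 / 2 / 2). \<forall>y\<in>ball 0 (1 / 2 / 2).
      \<bar>(w(0 := w0)) x - (w(0 := w0)) y\<bar> \<le> C * norm (x - y) powr \<alpha>"
    by blast
  then have H: "\<bar>(w(0 := w0)) x - (w(0 := w0)) y\<bar> \<le> C * norm (x - y) powr \<alpha>"
    if "x \<in> ball 0 (1/4)" "y \<in> ball 0 (1/4)" for x y
    using that by simp
  show ?thesis
  proof (cases "w0 > 0")
    case True
    have "hoelder_continuous_on (cball 0 1) (u(0 := - k * ln w0))"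
      by (rule hoelder_case[where r = "1/4", OF True _ _ H]) auto
    then show ?thesis by (intro disjI2 exI[of _ "u(0 := - k * ln w0)"]) auto
  next
    case False
    \<comment> \<open>As \<open>w0 \<le> 0 < w x\<close>, the value \<open>w x\<close> is at most
      \<open>|w x - w0|\<close>, and the Hoelder estimate at the origin becomes the decay from which
      the linear bound starts.\<close>
    have "w x \<le> C * norm x powr \<alpha>" if x: "x \<noteq> 0" "norm x < 1/4" for x
      using H[of x 0] x False by auto
    then obtain C' r1 where "C' > 0" "r1 > 0" "\<And>x. x \<noteq> 0 \<Longrightarrow> norm x \<le> r1 \<Longrightarrow> w x \<le> C' * norm x"
      using w_le_linear[of "1/4" C] by auto
    from log_limit[OF this] show ?thesis unfolding k_def by blast
  qed
qed

end

theorem theorem3: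
  fixes m a b q :: real and u :: "real^2 \<Rightarrow> real"
  assumes "m > 0" and "a > 0" and "b > 0" and "q > 2"
    and "C1_up_to_boundary (cball 0 1 - {0}) u"
    and "\<And>x. x \<in> ball 0 1 - {0} \<Longrightarrow> u x > 0"
    and "distributional_solution m a b q (ball 0 1 - {0}) u"
  shows "((\<lambda>x. u x / (- ln (norm x))) \<longlongrightarrow> q / b) (at 0) \<or>
         (\<exists>v. (\<forall>x\<in>cball 0 1 - {0}. v x = u x) \<and> hoelder_continuous_on (cball 0 1) v)"
proof -
  have "ball 0 1 - {0 :: real^2} \<subseteq> interior (cball 0 1 - {0})"
    by (rule interior_maximal) auto
  with assms(5) obtain g where "continuous_on (cball 0 1 - {0}) u" "continuous_on (cball 0 1 - {0}) g"
    "\<And>x. x \<in> ball 0 1 - {0} \<Longrightarrow> GDERIV u x :> g x"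
    unfolding C1_up_to_boundary_def by blast
  with assms interpret punctured_solution m a b q u g
    by unfold_locales
  show ?thesis by (rule dichotomy)
qed

end
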